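(* Let $\Gamma$ be a finite graph which is a Cayley graph, or a Cayley sum graph, or a twisted Cayley graph, or a twisted Cayley sum graph, or a vertex-transitive graph, and suppose that $\Gamma$ is undirected, connected and non-bipartite. Let $d$ be the degree of $\Gamma$, let $A_\Gamma=\frac1d A$ be its normalized adjacency operator, and let $\mu$ (resp. $\mu_2$) denote the smallest (resp. the second largest) eigenvalue of $A_\Gamma$. Then $$1+\mu\ \ge\ \frac{1-\mu_2}{50000\,d}.$$ Moreover, if the underlying group of $\Gamma$ is a finite simple group or is of odd order, then $$1+\mu\ \ge\ \frac{1-\mu_2}{2525}.$$
   Context: Graphs are finite, with at least two vertices, and may have multiple edges and loops; $A$ denotes the adjacency matrix $A=(a_{xy})$, where $a_{xy}$ is the number of edges from $x$ to $y$. The graph is undirected when $a_{xy}=a_{yx}$ for all $x,y$, and it is $d$-regular when $\sum_y a_{xy}=d$ for all $x$. Let $G$ be a finite group, let $S$ be a finite multiset of elements of $G$ with $|S|=d\ge1$ (counted with multiplicity), and let $\sigma$ be an automorphism of $G$. All of the following graphs have vertex set $G$ and are $d$-regular: - In the Cayley graph, $a_{xy}$ is the number of $s\in S$ (with multiplicity) such that $x=sy$. - In the Cayley sum graph, $a_{xy}$ is the number of $s\in S$ such that $x=y^{-1}s$. - In the twisted Cayley graph, $a_{xy}$ is the number of $s\in S$ such that $x=s\sigma(y)$. - In the twisted Cayley sum graph, $a_{xy}$ is the number of $s\in S$ such that $x=\sigma(y)^{-1}s$. For each of these four graphs the underlying group is $G$. A vertex-transitive graph is a finite undirected $d$-regular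 graph whose automorphism group acts transitively on its vertex set; its underlying group is taken to be its automorphism group. The graph is bipartite if its vertex set can be split into two parts such that every edge joins the two parts.
   Formalization: In the second bound, "finite simple group" excludes the group of order 2: for Z/2 with S consisting of one 0 and m > 2525 copies of 1, the bound 1+μ ≥ (1−μ₂)/2525 fails. *)

theory Defs
  imports
    "HOL-Algebra.Bij"
    "HOL-Algebra.SimpleGroups"
    "HOL-Library.Multiset"
    "Jordan_Normal_Form.Char_Poly"
begin

section \<open>Finite graphs with multiple edges and loops\<close>

text \<open>A graph is given by its vertex set and the numbers \<open>edges \<Gamma> x y\<close> of edges from
  \<open>x\<close> to \<open>y\<close>; only the values at \<open>x, y \<in> verts \<Gamma>\<close> are meaningful.\<close>

record 'v multigraph =
  verts :: "'v set"
  edges :: "'v \<Rightarrow> 'v \<Rightarrow> nat"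

definition undirected :: "'v multigraph \<Rightarrow> bool" where
  "undirected \<Gamma> \<longleftrightarrow> (\<forall>x\<in>verts \<Gamma>. \<forall>y\<in>verts \<Gamma>. edges \<Gamma> x y = edges \<Gamma> y x)"

definition regular :: "'v multigraph \<Rightarrow> nat \<Rightarrow> bool" where
  "regular \<Gamma> d \<longleftrightarrow> (\<forall>x\<in>verts \<Gamma>. (\<Sum>y\<in>verts \<Gamma>. edges \<Gamma> x y) = d)"

definition adjacency :: "'v multigraph \<Rightarrow> ('v \<times> 'v) set" where
  "adjacency \<Gamma> = {(x, y). x \<in> verts \<Gamma> \<and> y \<in> verts \<Gamma> \<and> edges \<Gamma> x y > 0}"

definition connected_graph :: "'v multigraph \<Rightarrow> bool" where
  "connected_graph \<Gamma> \<longleftrightarrow> (\<forall>x\<in>verts \<Gamma>. \<forall>y\<in>verts \<Gamma>. (x, y) \<in> (adjacency \<Gamma>)\<^sup>*)"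

definition bipartite_graph :: "'v multigraph \<Rightarrow> bool" where
  "bipartite_graph \<Gamma> \<longleftrightarrow>
    (\<exists>P Q. P \<union> Q = verts \<Gamma> \<and> P \<inter> Q = {} \<and>
       (\<forall>(x, y)\<in>adjacency \<Gamma>. x \<in> P \<and> y \<in> Q \<or> x \<in> Q \<and> y \<in> P))"


section \<open>Graphs attached to a group\<close>

text \<open>In the following definitions the filtered multisets count the \<open>s \<in> S\<close> with
  multiplicity, so \<open>edges \<Gamma> x y\<close> is the entry \<open>a\<^sub>x\<^sub>y\<close> of the adjacency matrix. The degree is
  \<open>size S\<close>. None of these graphs is undirected in general.\<close>

definition cayley_graph ::
    "'v monoid \<Rightarrow> 'v multiset \<Rightarrow> 'v multigraph \<Rightarrow> bool" where
  "cayley_graph G S \<Gamma> \<longleftrightarrow> verts \<Gamma> = carrier G \<and>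
    (\<forall>x\<in>carrier G. \<forall>y\<in>carrier G.
       edges \<Gamma> x y = size {# s \<in># S. x = s \<otimes>\<^bsub>G\<^esub> y #})"

definition cayley_sum_graph ::
    "'v monoid \<Rightarrow> 'v multiset \<Rightarrow> 'v multigraph \<Rightarrow> bool" where
  "cayley_sum_graph G S \<Gamma> \<longleftrightarrow> verts \<Gamma> = carrier G \<and>
    (\<forall>x\<in>carrier G. \<forall>y\<in>carrier G.
       edges \<Gamma> x y = size {# s \<in># S. x = inv\<^bsub>G\<^esub> y \<otimes>\<^bsub>G\<^esub> s #})"

definition twisted_cayley_graph ::
    "'v monoid \<Rightarrow> 'v multiset \<Rightarrow> ('v \<Rightarrow> 'v) \<Rightarrow> 'v multigraph \<Rightarrow> bool" where
  "twisted_cayley_graph G S \<sigma> \<Gamma> \<longleftrightarrow> verts \<Gamma> = carrier G \<and>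
    (\<forall>x\<in>carrier G. \<forall>y\<in>carrier G.
       edges \<Gamma> x y = size {# s \<in># S. x = s \<otimes>\<^bsub>G\<^esub> \<sigma> y #})"

definition twisted_cayley_sum_graph ::
    "'v monoid \<Rightarrow> 'v multiset \<Rightarrow> ('v \<Rightarrow> 'v) \<Rightarrow> 'v multigraph \<Rightarrow> bool" where
  "twisted_cayley_sum_graph G S \<sigma> \<Gamma> \<longleftrightarrow> verts \<Gamma> = carrier G \<and>
    (\<forall>x\<in>carrier G. \<forall>y\<in>carrier G.
       edges \<Gamma> x y = size {# s \<in># S. x = inv\<^bsub>G\<^esub> (\<sigma> y) \<otimes>\<^bsub>G\<^esub> s #})"

definition group_graph :: "'v monoid \<Rightarrow> 'v multigraph \<Rightarrow> bool" where
  "group_graph G \<Gamma> \<longleftrightarrow> group G \<and> finite (carrier G) \<and>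
    (\<exists>S \<sigma>. set_mset S \<subseteq> carrier G \<and> size S \<ge> 1 \<and> \<sigma> \<in> iso G G \<and>
       (cayley_graph G S \<Gamma> \<or> cayley_sum_graph G S \<Gamma> \<or>
        twisted_cayley_graph G S \<sigma> \<Gamma> \<or> twisted_cayley_sum_graph G S \<sigma> \<Gamma>))"


section \<open>Vertex-transitive graphs\<close>

definition graph_aut_group :: "'v multigraph \<Rightarrow> ('v \<Rightarrow> 'v) monoid" where
  "graph_aut_group \<Gamma> = (BijGroup (verts \<Gamma>))
    \<lparr>carrier := {\<pi> \<in> Bij (verts \<Gamma>).
       \<forall>x\<in>verts \<Gamma>. \<forall>y\<in>verts \<Gamma>. edges \<Gamma> (\<pi> x) (\<pi> y) = edges \<Gamma> x y}\<rparr>"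

definition vertex_transitive_graph :: "'v multigraph \<Rightarrow> bool" where
  "vertex_transitive_graph \<Gamma> \<longleftrightarrow> finite (verts \<Gamma>) \<and> undirected \<Gamma> \<and> (\<exists>d. regular \<Gamma> d) \<and>
    (\<forall>x\<in>verts \<Gamma>. \<forall>y\<in>verts \<Gamma>. \<exists>\<pi>\<in>carrier (graph_aut_group \<Gamma>). \<pi> x = y)"


section \<open>Eigenvalues of the normalized adjacency operator\<close>

text \<open>Writing the operator as a matrix needs an enumeration of the vertices. A different
  enumeration conjugates the matrix by a permutation matrix, so the eigenvalues do not
  depend on the choice.\<close>

definition vertex_list :: "'v multigraph \<Rightarrow> 'v list" where
  "vertex_list \<Gamma> = (SOME vs. distinct vs \<and> set vs = verts \<Gamma>)"

definition adjacency_matrix :: "'v multigraph \<Rightarrow> real mat" where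
  "adjacency_matrix \<Gamma> = Matrix.mat (card (verts \<Gamma>)) (card (verts \<Gamma>))
     (\<lambda>(i, j). real (edges \<Gamma> (vertex_list \<Gamma> ! i) (vertex_list \<Gamma> ! j)))"

definition normalized_adjacency :: "'v multigraph \<Rightarrow> nat \<Rightarrow> real mat" where
  "normalized_adjacency \<Gamma> d = (1 / real d) \<cdot>\<^sub>m adjacency_matrix \<Gamma>"

text \<open>Eigenvalues are counted with algebraic multiplicity. Only real roots are collected,
  which is all of them for a symmetric matrix.\<close>

definition eigenvalue_mset :: "real mat \<Rightarrow> real multiset" where
  "eigenvalue_mset M = proots (char_poly M)"

definition smallest_eigenvalue :: "real mat \<Rightarrow> real" where
  "smallest_eigenvalue M = Min_mset (eigenvalue_mset M)"

definition second_largest_eigenvalue :: "real mat \<Rightarrow> real" where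
  "second_largest_eigenvalue M =
     Max_mset (eigenvalue_mset M - {# Max_mset (eigenvalue_mset M) #})"


section \<open>The condition on the underlying group\<close>

text \<open>\<open>simple_group\<close> includes the group of order 2, for which the degree-independent bound
  fails: the Cayley graph of \<open>\<int>/2\<close> for the multiset with one 0 and \<open>m\<close> copies of 1
  is undirected, connected and non-bipartite, but \<open>\<mu> = \<mu>\<^sub>2 = (1 - m) / (1 + m)\<close>, so
  \<open>1 + \<mu> = 2 / (1 + m)\<close> and \<open>1 - \<mu>\<^sub>2 = 2 m / (1 + m)\<close>. Simple groups are therefore
  taken to have order different from 2.\<close>

definition simple_or_odd :: "('g, 'm) monoid_scheme \<Rightarrow> bool" where
  "simple_or_odd H \<longleftrightarrow> finite (carrier H) \<and>
     (simple_group H \<and> Coset.order H \<noteq> 2 \<or> odd (Coset.order H))"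

end

theory Submission
  imports Defs "HOL-Analysis.Function_Topology" "HOL-Algebra.Multiplicative_Group"
begin

text \<open>Let \<open>f\<close> be an eigenfunction for \<open>\<mu>\<close> and suppose \<open>10 (1 + \<mu>) < 1 - \<mu>\<^sub>2\<close>. The spectral gap makes
  \<open>|f|\<close> almost constant in mean square; since this holds for every eigenfunction, the
  eigenspace of \<open>\<mu>\<close> is one-dimensional. Right translation by a group element moves \<open>f\<close> to another
  eigenfunction: if \<open>a (P x) (Q y) = a x y\<close>, then \<open>f \<circ> P - f \<circ> Q\<close> is an eigenfunction for \<open>-\<mu> > \<mu>\<^sub>2\<close>
  orthogonal to the constants, hence zero. So \<open>f \<circ> Q = \<plusminus>f\<close>, and by transitivity \<open>|f|\<close> is exactly
  constant. As the graph is not bipartite, some edge joins two vertices of equal sign;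
  its translates give such an edge at every vertex, and \<open>1 + \<mu> \<ge> 2 / d\<close> follows from the quadratic
  form. The signs form a character of the group, which is trivial for groups that are of odd
  order, or simple of order other than 2; then \<open>f\<close> is constant, which is absurd.\<close>

section \<open>Reversible Markov kernels\<close>

text \<open>The first-order condition at a maximum, without derivatives: for small \<open>t\<close>
  of the sign of \<open>b\<close> the linear term dominates.\<close>

lemma quadratic_perturbation_zero:
  fixes b c :: real
  assumes "\<And>t. 2 * t * b + t\<^sup>2 * c \<le> 0"
  shows "b = 0"
proof (rule ccontr)
  assume b: "b \<noteq> 0"
  \<comment> \<open>This choice gives \<open>\<bar>t * c\<bar> < \<bar>b\<bar>\<close>, so the
    quadratic term cannot cancel the linear one.\<close>
  define t where "t = b / (\<bar>c\<bar> + 1)"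
  have t: "t * (\<bar>c\<bar> + 1) = b"
    by (simp add: t_def)
  have "2 * t * b + t\<^sup>2 * c = t\<^sup>2 * (2 * (\<bar>c\<bar> + 1) + c)"
    unfolding t[symmetric] by (simp add: power2_eq_square algebra_simps)
  moreover have "t\<^sup>2 * (2 * (\<bar>c\<bar> + 1) + c) > 0"
    using b by (intro mult_pos_pos) (auto simp: t_def)
  ultimately show False
    using assms[of t] by simp
qed

text \<open>Right translations of a group act on a twisted Cayley graph only as such pairs, with
  \<open>P \<noteq> Q\<close>; for a vertex-transitive graph \<open>P = Q\<close>.\<close>

definition aut_pair :: "'v set \<Rightarrow> ('v \<Rightarrow> 'v \<Rightarrow> 'b) \<Rightarrow> ('v \<Rightarrow> 'v) \<Rightarrow> ('v \<Rightarrow> 'v) \<Rightarrow> bool" where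
  "aut_pair V w P Q \<longleftrightarrow> bij_betw P V V \<and> bij_betw Q V V \<and>
    (\<forall>x\<in>V. \<forall>y\<in>V. w (P x) (Q y) = w x y)"

lemma aut_pair_in: "aut_pair V w P Q \<Longrightarrow> x \<in> V \<Longrightarrow> P x \<in> V \<and> Q x \<in> V"
  by (auto simp: aut_pair_def bij_betw_def)

text \<open>Symmetry makes the chain reversible for the uniform measure, so column sums are 1 as
  well and the averaging operator is self-adjoint.\<close>

locale markov_kernel =
  fixes V :: "'v set" and w :: "'v \<Rightarrow> 'v \<Rightarrow> real"
  assumes finite_V: "finite V"
    and nonneg: "x \<in> V \<Longrightarrow> y \<in> V \<Longrightarrow> 0 \<le> w x y"
    and sym: "x \<in> V \<Longrightarrow> y \<in> V \<Longrightarrow> w x y = w y x"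
    and stochastic: "x \<in> V \<Longrightarrow> (\<Sum>y\<in>V. w x y) = 1"
begin

section \<open>Inner product, averaging operator and Dirichlet forms\<close>

definition ip :: "('v \<Rightarrow> real) \<Rightarrow> ('v \<Rightarrow> real) \<Rightarrow> real" where
  "ip f g = (\<Sum>x\<in>V. f x * g x)"

definition avg :: "('v \<Rightarrow> real) \<Rightarrow> 'v \<Rightarrow> real" where
  "avg f x = (\<Sum>y\<in>V. w x y * f y)"

definition eigenfunction :: "real \<Rightarrow> ('v \<Rightarrow> real) \<Rightarrow> bool" where
  "eigenfunction k f \<longleftrightarrow> (\<forall>x\<in>V. avg f x = k * f x)"

lemma ip_commute: "ip f g = ip g f"
  by (simp add: ip_def mult.commute)

lemma ip_nonneg: "0 \<le> ip f f"
  by (simp add: ip_def sum_nonneg)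

lemma ip_eq_0_iff: "ip f f = 0 \<longleftrightarrow> (\<forall>x\<in>V. f x = 0)"
  unfolding ip_def using finite_V by (subst sum_nonneg_eq_0_iff) auto

lemma ip_pos: "x \<in> V \<Longrightarrow> f x \<noteq> 0 \<Longrightarrow> 0 < ip f f"
  using ip_nonneg[of f] ip_eq_0_iff[of f] by (metis less_eq_real_def)

lemma ip_cong: "(\<And>x. x \<in> V \<Longrightarrow> f x = f' x) \<Longrightarrow> (\<And>x. x \<in> V \<Longrightarrow> g x = g' x) \<Longrightarrow> ip f g = ip f' g'"
  by (simp add: ip_def)

lemma avg_cong: "(\<And>x. x \<in> V \<Longrightarrow> f x = f' x) \<Longrightarrow> avg f x = avg f' x"
  by (simp add: avg_def)

lemma ip_add_right: "ip f (\<lambda>x. g x + h x) = ip f g + ip f h"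
  by (simp add: ip_def sum.distrib algebra_simps)

lemma ip_scale_right: "ip f (\<lambda>x. c * g x) = c * ip f g"
  by (simp add: ip_def sum_distrib_left algebra_simps)

lemma ip_add_left: "ip (\<lambda>x. g x + h x) f = ip g f + ip h f"
  by (simp add: ip_def sum.distrib algebra_simps)

lemma ip_scale_left: "ip (\<lambda>x. c * g x) f = c * ip g f"
  by (simp add: ip_def sum_distrib_left algebra_simps)

lemma avg_add: "avg (\<lambda>x. f x + g x) = (\<lambda>x. avg f x + avg g x)"
  by (rule ext) (simp add: avg_def sum.distrib algebra_simps)

lemma avg_scale: "avg (\<lambda>x. c * f x) = (\<lambda>x. c * avg f x)"
  by (rule ext) (simp add: avg_def sum_distrib_left algebra_simps)

lemma avg_const: "x \<in> V \<Longrightarrow> avg (\<lambda>_. c) x = c"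
  by (simp add: avg_def sum_distrib_right[symmetric] stochastic)

lemma sum_weights_left: "(\<Sum>x\<in>V. \<Sum>y\<in>V. w x y * F x) = (\<Sum>x\<in>V. F x)"
  by (simp add: sum_distrib_right[symmetric] stochastic)

text \<open>Interchange the sums and use the symmetry of \<open>w\<close>. Column sums and
  self-adjointness both come from here.\<close>

lemma sum_weights_swap: "(\<Sum>x\<in>V. \<Sum>y\<in>V. w x y * F x y) = (\<Sum>x\<in>V. \<Sum>y\<in>V. w x y * F y x)"
  by (subst sum.swap) (intro sum.cong refl, simp add: sym)

lemma sum_weights_right: "(\<Sum>x\<in>V. \<Sum>y\<in>V. w x y * F y) = (\<Sum>x\<in>V. F x)"
  using sum_weights_swap[of "\<lambda>x y. F y"] sum_weights_left[of F] by simp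

lemma ip_avg: "ip f (avg g) = (\<Sum>x\<in>V. \<Sum>y\<in>V. w x y * (f x * g y))"
  by (simp add: ip_def avg_def sum_distrib_left algebra_simps)

lemma ip_avg_commute: "ip f (avg g) = ip (avg f) g"
  using sum_weights_swap[of "\<lambda>x y. f x * g y"]
  by (simp add: ip_avg ip_commute[of "avg f"] mult.commute)

lemma sum_avg: "(\<Sum>x\<in>V. avg f x) = (\<Sum>x\<in>V. f x)"
  by (simp add: avg_def sum_weights_right)

text \<open>Expand the square: rows and columns of \<open>w\<close> sum to 1, so each pure square
  contributes \<open>ip f f\<close>, and the mixed term is \<open>ip f (avg f)\<close> taken
  twice.\<close>

lemma dirichlet_minus:
  "(\<Sum>x\<in>V. \<Sum>y\<in>V. w x y * (f x - f y)\<^sup>2) = 2 * (ip f f - ip f (avg f))"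
proof -
  have "(\<Sum>x\<in>V. \<Sum>y\<in>V. w x y * (f x - f y)\<^sup>2)
      = (\<Sum>x\<in>V. \<Sum>y\<in>V. w x y * (f x)\<^sup>2 + w x y * (f y)\<^sup>2 - 2 * (w x y * (f x * f y)))"
    by (intro sum.cong refl) (simp add: power2_eq_square algebra_simps)
  also have "\<dots> = 2 * (ip f f - ip f (avg f))"
    by (simp add: sum.distrib sum_subtractf sum_distrib_left[symmetric] sum_weights_left
        sum_weights_right ip_avg) (simp add: ip_def power2_eq_square)
  finally show ?thesis .
qed

text \<open>The form of the signless Laplacian; it is small when \<open>f\<close> nearly reverses
  its sign along the edges, as happens for eigenvalues near -1.\<close>

lemma dirichlet_plus:
  "(\<Sum>x\<in>V. \<Sum>y\<in>V. w x y * (f x + f y)\<^sup>2) = 2 * (ip f f + ip f (avg f))"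
proof -
  have "(\<Sum>x\<in>V. \<Sum>y\<in>V. w x y * (f x + f y)\<^sup>2)
      = (\<Sum>x\<in>V. \<Sum>y\<in>V. w x y * (f x)\<^sup>2 + w x y * (f y)\<^sup>2 + 2 * (w x y * (f x * f y)))"
    by (intro sum.cong refl) (simp add: power2_eq_square algebra_simps)
  also have "\<dots> = 2 * (ip f f + ip f (avg f))"
    by (simp add: sum.distrib sum_subtractf sum_distrib_left[symmetric] sum_weights_left
        sum_weights_right ip_avg) (simp add: ip_def power2_eq_square)
  finally show ?thesis .
qed

lemma ip_avg_le: "ip f (avg f) \<le> ip f f"
proof -
  have "0 \<le> (\<Sum>x\<in>V. \<Sum>y\<in>V. w x y * (f x - f y)\<^sup>2)"
    by (intro sum_nonneg mult_nonneg_nonneg) (auto simp: nonneg)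
  then show ?thesis by (simp add: dirichlet_minus)
qed

lemma ip_avg_ge: "- ip f f \<le> ip f (avg f)"
proof -
  have "0 \<le> (\<Sum>x\<in>V. \<Sum>y\<in>V. w x y * (f x + f y)\<^sup>2)"
    by (intro sum_nonneg mult_nonneg_nonneg) (auto simp: nonneg)
  then show ?thesis by (simp add: dirichlet_plus)
qed

lemma ip_eigenfunction: "eigenfunction k f \<Longrightarrow> ip g (avg f) = k * ip g f"
  by (simp add: ip_def eigenfunction_def sum_distrib_left algebra_simps)

lemma eigenvalue_bounds:
  assumes "eigenfunction k f" "x \<in> V" "f x \<noteq> 0"
  shows "-1 \<le> k" "k \<le> 1"
proof -
  have p: "ip f f > 0" using assms ip_pos by blast
  have "k * ip f f \<le> 1 * ip f f" "(-1) * ip f f \<le> k * ip f f"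
    using ip_avg_le[of f] ip_avg_ge[of f] ip_eigenfunction[OF assms(1), of f] by auto
  with p show "-1 \<le> k" "k \<le> 1"
    unfolding mult_le_cancel_right by auto
qed

text \<open>Averaging preserves the total, yet multiplies the total of an eigenfunction by
  \<open>k\<close>.\<close>

lemma sum_eigenfunction: "eigenfunction k f \<Longrightarrow> k \<noteq> 1 \<Longrightarrow> (\<Sum>x\<in>V. f x) = 0"
  using sum_avg[of f] by (simp add: eigenfunction_def sum_distrib_left[symmetric])

lemma eigenfunction_add:
  "eigenfunction k f \<Longrightarrow> eigenfunction k g \<Longrightarrow> eigenfunction k (\<lambda>x. f x + g x)"
  by (simp add: eigenfunction_def avg_add algebra_simps)

lemma eigenfunction_scale: "eigenfunction k f \<Longrightarrow> eigenfunction k (\<lambda>x. c * f x)"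
  by (simp add: eigenfunction_def avg_scale)

section \<open>The second eigenvalue as a maximum of the Rayleigh quotient\<close>

text \<open>By Tychonoff: the value 0 outside \<open>V\<close> puts the sphere inside a product of
  compact sets, and the other conditions are closed because they involve finitely many
  coordinates.\<close>

lemma compact_unit_sphere:
  "compact {f. (\<forall>x. x \<notin> V \<longrightarrow> f x = 0) \<and> ip f f = 1 \<and> (\<Sum>x\<in>V. f x) = (0::real)}" (is "compact ?K")
proof -
  let ?B = "PiE UNIV (\<lambda>x::'v. if x \<in> V then {-1..1::real} else {0})"
  have "compactin (product_topology (\<lambda>i. euclidean) UNIV) ?B"
    by (auto simp: compactin_PiE)
  then have B: "compact ?B"
    by (simp add: euclidean_product_topology)
  have c: "continuous_on UNIV (\<lambda>f::'v \<Rightarrow> real. f x)" for x by simp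
  have "closed {f. ip f f = 1}"
    unfolding ip_def by (intro closed_Collect_eq continuous_intros c)
  moreover have "closed {f::'v \<Rightarrow> real. (\<Sum>x\<in>V. f x) = 0}"
    by (intro closed_Collect_eq continuous_intros c)
  ultimately have "compact (?B \<inter> ({f. ip f f = 1} \<inter> {f. (\<Sum>x\<in>V. f x) = 0}))"
    using B by (intro compact_Int_closed closed_Int)
  moreover have "?B \<inter> ({f. ip f f = 1} \<inter> {f. (\<Sum>x\<in>V. f x) = 0}) = ?K"
  proof -
    have "f x \<in> {-1..1}" if "ip f f = 1" "x \<in> V" for f x
    proof -
      have "f x * f x \<le> ip f f"
        unfolding ip_def using finite_V that by (intro member_le_sum) auto
      then have "(f x)\<^sup>2 \<le> 1" using that by (simp add: power2_eq_square)
      then have "\<bar>f x\<bar> \<le> 1" by (simp add: abs_square_le_1)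
      then show ?thesis by auto
    qed
    then show ?thesis by (auto simp: PiE_def Pi_def)
  qed
  ultimately show ?thesis by simp
qed

text \<open>A variational argument in place of diagonalisation: the Rayleigh quotient attains its
  maximum on the compact sphere of functions of sum zero, and criticality makes the maximiser an
  eigenfunction.\<close>

lemma exists_second_eigenfunction:
  assumes "card V \<ge> 2"
  obtains \<nu> g where "eigenfunction \<nu> g" "(\<Sum>x\<in>V. g x) = 0" "ip g g = 1"
    "\<And>h. (\<Sum>x\<in>V. h x) = 0 \<Longrightarrow> ip h (avg h) \<le> \<nu> * ip h h"
proof -
  let ?K = "{f. (\<forall>x. x \<notin> V \<longrightarrow> f x = 0) \<and> ip f f = 1 \<and> (\<Sum>x\<in>V. f x) = (0::real)}"
  have normalize: "\<exists>f\<in>?K. \<exists>c. c > 0 \<and> (\<forall>x\<in>V. f x = c * h x)"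
    if "(\<Sum>x\<in>V. h x) = 0" "ip h h > 0" for h
  proof -
    define c where "c = 1 / sqrt (ip h h)"
    have c: "c > 0" "c * c * ip h h = 1"
      using that by (auto simp: c_def)
    let ?f = "\<lambda>x. if x \<in> V then c * h x else 0"
    have "ip ?f ?f = c * c * ip h h"
      by (simp add: ip_def sum_distrib_left algebra_simps)
    moreover have "(\<Sum>x\<in>V. ?f x) = c * (\<Sum>x\<in>V. h x)"
      by (simp add: sum_distrib_left)
    ultimately have "?f \<in> ?K" using c that by simp
    then show ?thesis using c by (intro bexI[of _ ?f]) auto
  qed
  \<comment> \<open>The sphere is nonempty: the difference of two point masses has sum zero.\<close>
  have "\<exists>h. (\<Sum>x\<in>V. h x) = (0::real) \<and> ip h h > 0"
  proof -
    obtain a b where ab: "a \<in> V" "b \<in> V" "a \<noteq> b"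
      using assms by (metis card_le_Suc0_iff_eq finite_V not_less_eq_eq numeral_2_eq_2)
    let ?h = "\<lambda>x. (if x = a then 1 else 0) + (if x = b then -1 else (0::real))"
    have "(\<Sum>x\<in>V. ?h x) = 0"
      using ab finite_V by (simp add: sum.distrib)
    moreover have "ip ?h ?h > 0" using ab by (intro ip_pos[of a]) auto
    ultimately show ?thesis by blast
  qed
  with normalize have ne: "?K \<noteq> {}" by blast
  have c: "continuous_on UNIV (\<lambda>f::'v \<Rightarrow> real. f x)" for x by simp
  have cont: "continuous_on ?K (\<lambda>f. ip f (avg f))"
    unfolding ip_def avg_def
    by (intro continuous_intros continuous_on_subset[OF c]) auto
  obtain g where g: "g \<in> ?K" and max: "\<And>f. f \<in> ?K \<Longrightarrow> ip f (avg f) \<le> ip g (avg g)"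
    using continuous_attains_sup[OF compact_unit_sphere ne cont] by blast
  define \<nu> where "\<nu> = ip g (avg g)"
  have gg: "ip g g = 1" "(\<Sum>x\<in>V. g x) = 0" using g by auto
  have poincare: "ip h (avg h) \<le> \<nu> * ip h h" if h: "(\<Sum>x\<in>V. h x) = 0" for h
  proof (cases "ip h h > 0")
    case True
    then obtain f c where f: "f \<in> ?K" "c > 0" "\<And>x. x \<in> V \<Longrightarrow> f x = c * h x"
      using normalize[OF h] by blast
    have 1: "ip f (avg f) = c * (c * ip h (avg h))"
    proof -
      have "ip f (avg f) = ip (\<lambda>x. c * h x) (avg (\<lambda>x. c * h x))"
        by (intro ip_cong avg_cong) (auto simp: f)
      then show ?thesis by (simp add: avg_scale ip_scale_left ip_scale_right)
    qed
    have "ip f f = ip (\<lambda>x. c * h x) (\<lambda>x. c * h x)"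
      by (intro ip_cong) (auto simp: f)
    then have 2: "c * (c * ip h h) = 1"
      using f(1) by (simp add: ip_scale_left ip_scale_right)
    have "c * (c * ip h (avg h)) \<le> \<nu> * (c * (c * ip h h))"
      using max[OF f(1)] unfolding 1 2 \<nu>_def by simp
    then have "(c * c) * ip h (avg h) \<le> (c * c) * (\<nu> * ip h h)"
      by (simp add: algebra_simps)
    then show ?thesis using f(2) by (simp add: mult_le_cancel_left)
  next
    case False
    then have "ip h h = 0" using ip_nonneg[of h] by simp
    then have "ip h h = 0" "\<forall>x\<in>V. h x = 0" by (auto simp: ip_eq_0_iff)
    then show ?thesis by (simp add: ip_def)
  qed
  \<comment> \<open>First-order condition at the maximiser, tested against the residual itself.\<close>
  define r where "r = (\<lambda>x. avg g x + (- \<nu>) * g x)"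
  have r0: "(\<Sum>x\<in>V. r x) = 0"
    by (simp add: r_def sum_subtractf sum_avg gg sum_distrib_left[symmetric])
  have "ip r r = 0"
  proof (rule quadratic_perturbation_zero[where c = "ip r (avg r) - \<nu> * ip r r"])
    fix t
    let ?f = "\<lambda>x. g x + t * r x"
    have "(\<Sum>x\<in>V. ?f x) = 0"
      by (simp add: sum.distrib gg r0 sum_distrib_left[symmetric])
    note P = poincare[OF this]
    have 1: "ip ?f (avg ?f) = \<nu> + 2 * t * ip r (avg g) + t * t * ip r (avg r)"
      by (simp add: avg_add avg_scale ip_add_left ip_add_right ip_scale_left ip_scale_right
          \<nu>_def ip_avg_commute[of g r] ip_commute[of "avg g"] algebra_simps)
    have 2: "ip ?f ?f = 1 + 2 * t * ip r g + t * t * ip r r"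
      by (simp add: ip_add_left ip_add_right ip_scale_left ip_scale_right
          gg ip_commute[of g r] algebra_simps)
    \<comment> \<open>Identifies the linear coefficient of the perturbation as
      \<open>ip r r\<close>, so that its vanishing kills the residual.\<close>
    have 3: "ip r r = ip r (avg g) - \<nu> * ip r g"
      by (subst (2) r_def, unfold ip_add_right ip_scale_right) simp
    show "2 * t * ip r r + t\<^sup>2 * (ip r (avg r) - \<nu> * ip r r) \<le> 0"
      using P unfolding 1 2 by (simp add: 3 power2_eq_square algebra_simps)
  qed
  then have "eigenfunction \<nu> g"
    by (simp add: ip_eq_0_iff eigenfunction_def r_def)
  with gg poincare that show ?thesis by blast
qed

text \<open>Change variables in the average at \<open>P x\<close>, and at \<open>Q x\<close> after
  using the symmetry of \<open>w\<close>. Averaging thus interchanges the two pull-backs up to the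
  factor \<open>k\<close>, so their difference belongs to \<open>-k\<close>.\<close>

lemma eigenfunction_pull:
  assumes "eigenfunction k f" and PQ: "aut_pair V w P Q" and "x \<in> V"
  shows "avg (\<lambda>y. f (Q y)) x = k * f (P x)" "avg (\<lambda>y. f (P y)) x = k * f (Q x)"
proof -
  have bP: "bij_betw P V V" and bQ: "bij_betw Q V V"
    and inv: "\<And>x y. x \<in> V \<Longrightarrow> y \<in> V \<Longrightarrow> w (P x) (Q y) = w x y"
    using PQ by (auto simp: aut_pair_def)
  have P: "P x \<in> V" and Q: "Q x \<in> V"
    using aut_pair_in[OF PQ \<open>x \<in> V\<close>] by auto
  have "avg (\<lambda>y. f (Q y)) x = (\<Sum>y\<in>V. w (P x) (Q y) * f (Q y))"
    unfolding avg_def by (intro sum.cong refl) (simp add: inv \<open>x \<in> V\<close>)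
  also have "\<dots> = avg f (P x)"
    unfolding avg_def by (rule sum.reindex_bij_betw[OF bQ])
  finally show "avg (\<lambda>y. f (Q y)) x = k * f (P x)"
    using assms(1) P by (simp add: eigenfunction_def)
  have "avg (\<lambda>y. f (P y)) x = (\<Sum>y\<in>V. w (Q x) (P y) * f (P y))"
    unfolding avg_def
  proof (intro sum.cong refl)
    fix y assume y: "y \<in> V"
    then have "P y \<in> V" using aut_pair_in[OF PQ] by blast
    then show "w x y * f (P y) = w (Q x) (P y) * f (P y)"
      using inv[OF y \<open>x \<in> V\<close>] sym[OF Q] sym[OF y \<open>x \<in> V\<close>] by simp
  qed
  also have "\<dots> = avg f (Q x)"
    unfolding avg_def by (rule sum.reindex_bij_betw[OF bP])
  finally show "avg (\<lambda>y. f (P y)) x = k * f (Q x)"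
    using assms(1) Q by (simp add: eigenfunction_def)
qed

end

section \<open>Simplicity of the eigenvalue 1\<close>

locale connected_kernel = markov_kernel V w for V :: "'v set" and w +
  assumes connected: "x \<in> V \<Longrightarrow> y \<in> V \<Longrightarrow>
      (x, y) \<in> {(x, y). x \<in> V \<and> y \<in> V \<and> w x y > 0}\<^sup>*"
begin

text \<open>The Dirichlet form of \<open>f\<close> vanishes, hence \<open>f\<close> agrees at the
  ends of every edge, and connectedness propagates the value.\<close>

lemma eigenfunction_one_const:
  assumes "eigenfunction 1 f" "x \<in> V" "y \<in> V"
  shows "f x = f y"
proof -
  have "(\<Sum>x\<in>V. \<Sum>y\<in>V. w x y * (f x - f y)\<^sup>2) = 0"
    by (simp add: dirichlet_minus ip_eigenfunction[OF assms(1)])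
  then have *: "w x y * (f x - f y)\<^sup>2 = 0" if "x \<in> V" "y \<in> V" for x y
    using that finite_V by (simp add: sum_nonneg_eq_0_iff sum_nonneg nonneg)
  have "(x, y) \<in> {(x, y). x \<in> V \<and> y \<in> V \<and> w x y > 0}\<^sup>*"
    using assms connected by blast
  then show ?thesis
  proof (induction rule: rtrancl_induct)
    case (step y z)
    then have "w y z * (f y - f z)\<^sup>2 = 0" "w y z > 0" using *[of y z] by auto
    then have "f y = f z" by auto
    then show ?case using step by simp
  qed simp
qed

lemma eigenfunction_one_zero:
  assumes "eigenfunction 1 f" "(\<Sum>x\<in>V. f x) = 0" "x \<in> V"
  shows "f x = 0"
proof -
  have "(\<Sum>y\<in>V. f y) = (\<Sum>y\<in>V. f x)"
    by (intro sum.cong refl eigenfunction_one_const[OF assms(1)] assms(3))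
  then show ?thesis using assms finite_V by auto
qed

end

section \<open>Variance under a spectral gap\<close>

locale spectral_gap = markov_kernel V w for V :: "'v set" and w +
  fixes \<nu> :: real
  assumes poincare: "(\<Sum>x\<in>V. h x) = 0 \<Longrightarrow> ip h (avg h) \<le> \<nu> * ip h h"
    and gap_pos: "\<nu> < 1"
    and card_V: "card V > 0"
begin

text \<open>The Poincare inequality is applied to \<open>h\<close> minus its mean \<open>m\<close>.
  Constants are fixed by \<open>avg\<close>, so \<open>ip h h\<close> and
  \<open>ip h (avg h)\<close> both drop by \<open>card V * m\<^sup>2\<close> and their difference is
  unchanged.\<close>

lemma variance_bound:
  "(1 - \<nu>) * (ip h h - (\<Sum>x\<in>V. h x)\<^sup>2 / card V) \<le> ip h h - ip h (avg h)"
proof -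
  define m where "m = (\<Sum>x\<in>V. h x) / card V"
  have s: "(\<Sum>x\<in>V. h x) = card V * m" using card_V by (simp add: m_def)
  \<comment> \<open>The mean is written as \<open>(-m) * 1\<close> so that the sum and scaling rules
    apply to it.\<close>
  define u where "u = (\<lambda>x. h x + (-m) * 1)"
  have u0: "(\<Sum>x\<in>V. u x) = 0" by (simp add: u_def sum_subtractf s)
  have h1: "ip h (\<lambda>x. 1) = card V * m" "ip (\<lambda>x. 1) h = card V * m"
    by (simp_all add: ip_def s)
  have 11: "ip (\<lambda>x. 1) (\<lambda>x. 1) = card V" by (simp add: ip_def)
  have a1: "ip g (avg (\<lambda>x. 1)) = ip g (\<lambda>x. 1)" for g
    by (intro ip_cong) (auto simp: avg_const)
  have 1: "ip u u = ip h h - card V * m\<^sup>2"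
    unfolding u_def ip_add_left ip_add_right ip_scale_left ip_scale_right h1 11
    by (simp add: power2_eq_square algebra_simps)
  have "ip (\<lambda>x. 1) (avg h) = card V * m"
    using ip_avg_commute[of "\<lambda>x. 1" h] a1[of h] h1 by (simp add: ip_commute)
  then have 2: "ip u (avg u) = ip h (avg h) - card V * m\<^sup>2"
    unfolding u_def avg_add avg_scale ip_add_left ip_add_right ip_scale_left ip_scale_right a1 h1 11
    by (simp add: power2_eq_square algebra_simps)
  have "(\<Sum>x\<in>V. h x)\<^sup>2 / card V = card V * m\<^sup>2"
    unfolding s using card_V by (simp add: power2_eq_square)
  then show ?thesis
    using poincare[OF u0] unfolding 1 2 by (simp add: algebra_simps)
qed

lemma eigenvalue_le_gap:
  assumes "eigenfunction k f" "(\<Sum>x\<in>V. f x) = 0" "x \<in> V" "f x \<noteq> 0"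
  shows "k \<le> \<nu>"
  using poincare[OF assms(2)] ip_eigenfunction[OF assms(1), of f] ip_pos[of x f] assms(3,4)
  by simp

end

section \<open>Eigenfunctions for an eigenvalue close to -1\<close>

text \<open>The factor 10 is the tolerance of the argument: it leaves the 9/10 of
  \<open>abs_concentrated\<close>, which is enough for the numerical contradiction in
  \<open>no_orthogonal_pair\<close>.\<close>

locale nearly_bipartite = spectral_gap V w \<nu> for V :: "'v set" and w and \<nu> +
  fixes \<mu> :: real
  assumes near: "10 * (1 + \<mu>) < 1 - \<nu>" and near_pos: "-1 \<le> \<mu>"
begin

text \<open>Taking absolute values turns the form of \<open>f x + f y\<close> into that of \<open>|f x| - |f y|\<close>,
  so the spectral gap forces \<open>|f|\<close> to be almost constant.\<close>

lemma abs_concentrated: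
  assumes "eigenfunction \<mu> f"
  shows "(\<Sum>x\<in>V. \<bar>f x\<bar>)\<^sup>2 \<ge> 9/10 * card V * ip f f"
proof -
  let ?h = "\<lambda>x. \<bar>f x\<bar>"
  have hh: "ip ?h ?h = ip f f" by (simp add: ip_def)
  have "(\<Sum>x\<in>V. \<Sum>y\<in>V. w x y * (?h x - ?h y)\<^sup>2) \<le> (\<Sum>x\<in>V. \<Sum>y\<in>V. w x y * (f x + f y)\<^sup>2)"
  proof (intro sum_mono mult_left_mono)
    fix x y
    have "\<bar>?h x - ?h y\<bar> \<le> \<bar>f x + f y\<bar>" by linarith
    then show "(?h x - ?h y)\<^sup>2 \<le> (f x + f y)\<^sup>2"
      using abs_le_square_iff by blast
  qed (auto simp: nonneg)
  then have "ip ?h ?h - ip ?h (avg ?h) \<le> (1 + \<mu>) * ip f f"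
    by (simp add: dirichlet_minus dirichlet_plus ip_eigenfunction[OF assms] algebra_simps)
  with variance_bound[of ?h]
  have "(1 - \<nu>) * (ip f f - (\<Sum>x\<in>V. ?h x)\<^sup>2 / card V) \<le> (1 + \<mu>) * ip f f"
    unfolding hh by linarith
  also have "\<dots> \<le> ((1 - \<nu>) / 10) * ip f f"
    using near ip_nonneg by (intro mult_right_mono) auto
  finally have "(1 - \<nu>) * (ip f f - (\<Sum>x\<in>V. ?h x)\<^sup>2 / card V) \<le> (1 - \<nu>) * (ip f f / 10)"
    by simp
  then have "ip f f - (\<Sum>x\<in>V. ?h x)\<^sup>2 / card V \<le> ip f f / 10"
    using gap_pos by (simp add: mult_le_cancel_left)
  then show ?thesis
    using card_V by (simp add: field_simps)
qed

text \<open>The square root of the concentration bound for a function of mean square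
  \<open>c\<close>. A rational \<open>r\<close> replaces the root, so later estimates are linear
  arithmetic.\<close>

lemma abs_sum_ge:
  fixes f :: "'v \<Rightarrow> real" and r c :: real
  assumes "eigenfunction \<mu> f" "ip f f = c * card V" "r \<ge> 0" "r\<^sup>2 \<le> 9/10 * c"
  shows "(\<Sum>x\<in>V. \<bar>f x\<bar>) \<ge> r * card V"
proof -
  have "(r * card V)\<^sup>2 = r\<^sup>2 * (real (card V) * real (card V))"
    by (simp add: power2_eq_square)
  also have "\<dots> \<le> (9/10 * c) * (real (card V) * real (card V))"
    using assms by (intro mult_right_mono) auto
  also have "\<dots> \<le> (\<Sum>x\<in>V. \<bar>f x\<bar>)\<^sup>2"
    using abs_concentrated[OF assms(1)] by (simp add: assms(2) algebra_simps)
  finally show ?thesis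
    by (rule power2_le_imp_le) (simp add: sum_nonneg)
qed

text \<open>If \<open>f\<close> and \<open>g\<close> were orthonormal, then \<open>f\<close>, \<open>g\<close>, \<open>f + g\<close> and \<open>f - g\<close> would all have
  almost constant modulus, although \<open>max |f| |g| = (|f + g| + |f - g|) / 2\<close>. The numbers 13/10
  and 11/20 are close to the optimal tangent point of the quadratic inequality used.\<close>

lemma no_orthogonal_pair:
  assumes "eigenfunction \<mu> f" "eigenfunction \<mu> g"
    and "ip f f = card V" "ip g g = card V" "ip f g = 0"
  shows False
proof -
  let ?n = "real (card V)"
  \<comment> \<open>Mean square 1: the square of 0.94 is 0.8836, below 0.9.\<close>
  have f: "(\<Sum>x\<in>V. \<bar>f x\<bar>) \<ge> 94/100 * ?n" and g: "(\<Sum>x\<in>V. \<bar>g x\<bar>) \<ge> 94/100 * ?n"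
    using assms by (intro abs_sum_ge[where c = 1]; simp add: power2_eq_square)+
  \<comment> \<open>By orthogonality the mean square is 2, and the square of 1.34 is 1.7956, below
    1.8.\<close>
  have p: "(\<Sum>x\<in>V. \<bar>f x + g x\<bar>) \<ge> 134/100 * ?n"
  proof (rule abs_sum_ge[where c = 2])
    show "ip (\<lambda>x. f x + g x) (\<lambda>x. f x + g x) = 2 * ?n"
      using assms by (simp add: ip_add_left ip_add_right ip_commute[of g f])
  qed (use assms eigenfunction_add in \<open>auto simp: power2_eq_square\<close>)
  have m: "(\<Sum>x\<in>V. \<bar>f x + (-1) * g x\<bar>) \<ge> 134/100 * ?n"
  proof (rule abs_sum_ge[where c = 2])
    show "ip (\<lambda>x. f x + (-1) * g x) (\<lambda>x. f x + (-1) * g x) = 2 * ?n"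
      unfolding ip_add_left ip_add_right ip_scale_left ip_scale_right
      using assms by (simp add: ip_commute[of g f])
  qed (use assms eigenfunction_add[OF assms(1) eigenfunction_scale[OF assms(2), of "-1"]]
       in \<open>auto simp: power2_eq_square\<close>)
  \<comment> \<open>With \<open>M\<close> and \<open>N\<close> the larger and smaller modulus, the
    summand on the right is the tangent plane \<open>2.6 * M + 1.1 * N - 1.9925\<close> of
    \<open>M * M + N * N\<close> at (1.3, 0.55), where 1.9925 is 1.69 + 0.3025.\<close>
  have "(\<Sum>x\<in>V. f x * f x + g x * g x) \<ge> (\<Sum>x\<in>V. 75/100 * (\<bar>f x + g x\<bar> + \<bar>f x + (-1) * g x\<bar>)
      + 11/10 * (\<bar>f x\<bar> + \<bar>g x\<bar>) - 19925/10000)"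
  proof (rule sum_mono)
    fix x
    define M N where "M = max \<bar>f x\<bar> \<bar>g x\<bar>" and "N = min \<bar>f x\<bar> \<bar>g x\<bar>"
    have 1: "\<bar>f x + g x\<bar> + \<bar>f x + (-1) * g x\<bar> = 2 * M" "\<bar>f x\<bar> + \<bar>g x\<bar> = M + N"
      unfolding M_def N_def by linarith+
    have "f x * f x + g x * g x = \<bar>f x\<bar> * \<bar>f x\<bar> + \<bar>g x\<bar> * \<bar>g x\<bar>" by simp
    also have "\<dots> = M * M + N * N"
      by (cases "\<bar>f x\<bar> \<le> \<bar>g x\<bar>") (simp_all add: M_def N_def del: abs_mult_self_eq)
    finally have 2: "f x * f x + g x * g x = M * M + N * N" .
    have "0 \<le> (M - 13/10)\<^sup>2 + (N - 11/20)\<^sup>2" by simp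
    then show "75/100 * (\<bar>f x + g x\<bar> + \<bar>f x + (-1) * g x\<bar>)
      + 11/10 * (\<bar>f x\<bar> + \<bar>g x\<bar>) - 19925/10000 \<le> f x * f x + g x * g x"
      unfolding 1 2 power2_eq_square by argo
  qed
  moreover have "(\<Sum>x\<in>V. f x * f x + g x * g x) = 2 * ?n"
    using assms by (simp add: sum.distrib ip_def)
  moreover have "(\<Sum>x\<in>V. 75/100 * (\<bar>f x + g x\<bar> + \<bar>f x + (-1) * g x\<bar>)
      + 11/10 * (\<bar>f x\<bar> + \<bar>g x\<bar>) - 19925/10000) =
      75/100 * (\<Sum>x\<in>V. \<bar>f x + g x\<bar>) + 75/100 * (\<Sum>x\<in>V. \<bar>f x + (-1) * g x\<bar>)
      + (11/10 * (\<Sum>x\<in>V. \<bar>f x\<bar>) + 11/10 * (\<Sum>x\<in>V. \<bar>g x\<bar>)) - ?n * (19925/10000)"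
    by (simp only: distrib_left sum.distrib sum_subtractf sum_distrib_left[symmetric] sum_constant)
  \<comment> \<open>Per vertex the right side is at least 0.75 * 2.68 + 1.1 * 1.88 - 1.9925 =
    2.0855, while the left side is 2.\<close>
  ultimately show False using f g p m card_V by linarith
qed

text \<open>Gram-Schmidt: a nonzero residual of \<open>g\<close> after projection to
  \<open>f\<close> could be rescaled, together with \<open>f\<close>, to the orthogonal pair just
  excluded.\<close>

lemma eigenfunction_unique:
  assumes f: "eigenfunction \<mu> f" and g: "eigenfunction \<mu> g" and x: "x \<in> V" "f x \<noteq> 0"
  obtains c where "\<And>y. y \<in> V \<Longrightarrow> g y = c * f y"
proof -
  have ff: "ip f f > 0" using ip_pos x by blast
  define c where "c = ip f g / ip f f"
  define h where "h = (\<lambda>x. g x + (-c) * f x)"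
  have h: "eigenfunction \<mu> h"
    unfolding h_def by (intro eigenfunction_add eigenfunction_scale f g)
  have fh: "ip f h = 0"
    unfolding h_def ip_add_right ip_scale_right using ff by (simp add: c_def)
  have "ip h h = 0"
  proof (rule ccontr)
    assume "ip h h \<noteq> 0"
    then have hh: "ip h h > 0" using ip_nonneg[of h] by simp
    define a b where "a = sqrt (card V / ip f f)" and "b = sqrt (card V / ip h h)"
    have ab: "a * (a * ip f f) = card V" "b * (b * ip h h) = card V"
      using ff hh by (simp_all add: a_def b_def mult.assoc[symmetric])
    show False
    proof (rule no_orthogonal_pair)
      show "eigenfunction \<mu> (\<lambda>x. a * f x)" "eigenfunction \<mu> (\<lambda>x. b * h x)"
        by (intro eigenfunction_scale f h)+
    qed (simp_all add: ip_scale_left ip_scale_right fh ab)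
  qed
  then have "g y = c * f y" if "y \<in> V" for y
    using that by (auto simp: ip_eq_0_iff h_def)
  then show ?thesis using that by blast
qed

text \<open>The difference of the two pull-backs is an eigenfunction for \<open>-\<mu>\<close>, which lies
  above the gap, so it vanishes.\<close>

lemma pull_backs_agree:
  assumes f: "eigenfunction \<mu> f"
    and PQ: "aut_pair V w P Q"
    and x: "x \<in> V"
  shows "f (P x) = f (Q x)"
proof (rule ccontr)
  assume ne: "f (P x) \<noteq> f (Q x)"
  have P: "bij_betw P V V" and Q: "bij_betw Q V V" using PQ by (auto simp: aut_pair_def)
  let ?u = "\<lambda>x. f (P x) + (-1) * f (Q x)"
  note pull = eigenfunction_pull[OF f PQ]
  have "eigenfunction (- \<mu>) ?u"
    unfolding eigenfunction_def avg_add avg_scale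
    by (simp add: pull algebra_simps)
  moreover have "(\<Sum>x\<in>V. ?u x) = 0"
    by (simp add: sum_subtractf sum.reindex_bij_betw[OF P, of f] sum.reindex_bij_betw[OF Q, of f])
  moreover have "?u x \<noteq> 0" using ne by simp
  ultimately have "- \<mu> \<le> \<nu>" by (rule eigenvalue_le_gap[OF _ _ x])
  \<comment> \<open>As \<open>1 + \<mu> \<ge> 0\<close>, the assumption \<open>near\<close> yields
    \<open>\<nu> < 1 - 10 * (1 + \<mu>) \<le> -\<mu>\<close>.\<close>
  then show False using near near_pos by argo
qed

text \<open>Since both pull-backs agree, the one along \<open>Q\<close> is an eigenfunction for
  \<open>\<mu>\<close> itself, hence a multiple \<open>c\<close> of \<open>f\<close>;
  \<open>Q\<close> permutes \<open>V\<close> and preserves the norm, so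
  \<open>c * c = 1\<close>.\<close>

lemma pull_back_sign:
  assumes f: "eigenfunction \<mu> f"
    and PQ: "aut_pair V w P Q"
    and x: "x \<in> V" "f x \<noteq> 0"
  obtains c :: real where "c = 1 \<or> c = -1" "\<And>y. y \<in> V \<Longrightarrow> f (Q y) = c * f y"
proof -
  have "eigenfunction \<mu> (\<lambda>y. f (Q y))"
    using eigenfunction_pull(1)[OF f PQ] pull_backs_agree[OF f PQ]
    by (simp add: eigenfunction_def)
  then obtain c where c: "\<And>y. y \<in> V \<Longrightarrow> f (Q y) = c * f y"
    using eigenfunction_unique[OF f _ x] by metis
  have "ip f f = ip (\<lambda>y. f (Q y)) (\<lambda>y. f (Q y))"
    unfolding ip_def using PQ sum.reindex_bij_betw[of Q V V "\<lambda>x. f x * f x"]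
    by (simp add: aut_pair_def)
  also have "\<dots> = ip (\<lambda>y. c * f y) (\<lambda>y. c * f y)"
    by (intro ip_cong) (auto simp: c)
  finally have "ip f f = c * (c * ip f f)"
    by (simp add: ip_scale_left ip_scale_right)
  moreover have "ip f f > 0" using ip_pos x by blast
  ultimately have "c * c = 1"
    by (metis mult.assoc mult_cancel_right1 order_less_irrefl)
  then have "c = 1 \<or> c = -1" by (simp add: square_eq_1_iff)
  then show ?thesis using c that by blast
qed

lemma abs_const:
  assumes f: "eigenfunction \<mu> f"
    and trans: "\<And>x y. x \<in> V \<Longrightarrow> y \<in> V \<Longrightarrow> \<exists>P Q. aut_pair V w P Q \<and> Q x = y"
    and "x \<in> V" "f x \<noteq> 0" "y \<in> V"
  shows "\<bar>f y\<bar> = \<bar>f x\<bar>"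
proof -
  obtain P Q where PQ: "aut_pair V w P Q" "Q x = y" using trans assms by blast
  obtain c :: real where "c = 1 \<or> c = -1" "f (Q x) = c * f x"
    using pull_back_sign[OF f PQ(1) assms(3,4)] assms(3) by metis
  with PQ show ?thesis by auto
qed

text \<open>An edge on which \<open>f\<close> keeps its sign can be moved to every vertex.\<close>

lemma monochromatic_edge_bound:
  assumes f: "eigenfunction \<mu> f"
    and trans: "\<And>x y. x \<in> V \<Longrightarrow> y \<in> V \<Longrightarrow> \<exists>P Q. aut_pair V w P Q \<and> Q x = y"
    and edge: "a \<in> V" "b \<in> V" "f a * f b > 0" "w a b \<ge> \<delta>" and "\<delta> \<ge> 0"
  shows "2 * \<delta> \<le> 1 + \<mu>"
proof -
  have b: "f b \<noteq> 0" using edge by auto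
  define k where "k = f b * f b"
  have k: "k > 0" using b by (simp add: k_def zero_less_mult_iff) linarith
  have sq: "f y * f y = k" if "y \<in> V" for y
    using abs_const[OF f trans edge(2) b that] unfolding k_def
    by (metis abs_mult_self_eq)
  have vertex: "4 * \<delta> * k \<le> (\<Sum>x\<in>V. w y x * (f y + f x)\<^sup>2)" if y: "y \<in> V" for y
  proof -
    obtain P Q where PQ: "aut_pair V w P Q" "Q b = y" using trans edge y by blast
    obtain c :: real where c: "c = 1 \<or> c = -1" "\<And>z. z \<in> V \<Longrightarrow> f (Q z) = c * f z"
      using pull_back_sign[OF f PQ(1) edge(2) b] by metis
    \<comment> \<open>The pair carries the edge from \<open>a\<close> to \<open>b\<close> to one
      from \<open>P a\<close> to \<open>Q b\<close>, which is \<open>y\<close>. Agreement of the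
      pull-backs gives \<open>P a\<close> the same sign change as \<open>Q b\<close>.\<close>
    define x where "x = P a"
    have x: "x \<in> V" "f x = c * f a" "w x y = w a b"
      using aut_pair_in[OF PQ(1)] pull_backs_agree[OF f PQ(1)] c edge PQ
      by (auto simp: x_def aut_pair_def)
    have "f x * f y = f a * f b"
      using c edge(2) PQ x by auto
    then have "f x * f y > 0" using edge by simp
    moreover have "(f x * f y) * (f x * f y) = k * k"
      using sq[OF x(1)] sq[OF y] by (metis mult.assoc mult.left_commute)
    ultimately have "f x * f y = k"
      using k by (auto simp: square_eq_iff)
    then have "(f y + f x)\<^sup>2 = 4 * k"
      using sq[OF x(1)] sq[OF y] by (simp add: power2_eq_square algebra_simps)
    then have "4 * \<delta> * k \<le> w y x * (f y + f x)\<^sup>2"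
      using edge x sym[OF x(1) y] k by (simp add: mult_right_mono)
    also have "\<dots> \<le> (\<Sum>x\<in>V. w y x * (f y + f x)\<^sup>2)"
      using finite_V x y nonneg by (intro member_le_sum) auto
    finally show ?thesis .
  qed
  have "ip f f = card V * k"
    unfolding ip_def by (simp add: sq)
  \<comment> \<open>Summed over all vertices, the right side becomes the signless form, which equals
    \<open>2 * (1 + \<mu>) * ip f f\<close>.\<close>
  moreover have "(\<Sum>y\<in>V. 4 * \<delta> * k) \<le> (\<Sum>y\<in>V. \<Sum>x\<in>V. w y x * (f y + f x)\<^sup>2)"
    by (intro sum_mono vertex)
  ultimately have "(card V * k) * (4 * \<delta>) \<le> (card V * k) * (2 * (1 + \<mu>))"
    unfolding dirichlet_plus ip_eigenfunction[OF f] by (simp add: algebra_simps)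
  then show ?thesis
    using k card_V by (simp add: mult_le_cancel_left)
qed

end

section \<open>Sign characters\<close>

text \<open>An element of value -1 would have even order, which excludes odd groups. In a simple
  group the kernel would be trivial, so the group would embed in the signs and have order 2.\<close>

lemma sign_character_trivial:
  fixes \<chi> :: "'g \<Rightarrow> real"
  assumes "group H" and H: "simple_or_odd H"
    and sign: "\<And>g. g \<in> carrier H \<Longrightarrow> \<chi> g = 1 \<or> \<chi> g = -1"
    and mult: "\<And>g h. g \<in> carrier H \<Longrightarrow> h \<in> carrier H \<Longrightarrow> \<chi> (g \<otimes>\<^bsub>H\<^esub> h) = \<chi> g * \<chi> h"
    and g: "g \<in> carrier H"
  shows "\<chi> g = 1"
proof (rule ccontr)
  assume "\<chi> g \<noteq> 1"
  with sign g have \<chi>g: "\<chi> g = -1" by blast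
  interpret group H by fact
  have fin: "finite (carrier H)" using H by (simp add: simple_or_odd_def)
  have one: "\<chi> \<one>\<^bsub>H\<^esub> = 1"
    using mult[of "\<one>\<^bsub>H\<^esub>" "\<one>\<^bsub>H\<^esub>"] sign[of "\<one>\<^bsub>H\<^esub>"] by auto
  have inv: "\<chi> (inv\<^bsub>H\<^esub> h) = \<chi> h" if "h \<in> carrier H" for h
    using mult[of h "inv\<^bsub>H\<^esub> h"] sign[of h] that one by auto
  have odd_case: False if "odd (Coset.order H)"
  proof -
    have "\<chi> (g [^]\<^bsub>H\<^esub> n) = (-1) ^ n" for n :: nat
      by (induction n) (auto simp: one mult g \<chi>g)
    then have "(1::real) = (-1) ^ Coset.order H"
      using pow_order_eq_1[OF g] one by metis
    with that show False by simp
  qed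
  have simple_case: False if "simple_group H" "Coset.order H \<noteq> 2"
  proof -
    let ?K = "{h \<in> carrier H. \<chi> h = 1}"
    have "subgroup ?K H"
      by unfold_locales (auto simp: mult one inv)
    moreover have "x \<otimes>\<^bsub>H\<^esub> h \<otimes>\<^bsub>H\<^esub> inv\<^bsub>H\<^esub> x \<in> ?K"
      if x: "x \<in> carrier H" and h: "h \<in> ?K" for x h
    proof -
      have "\<chi> (x \<otimes>\<^bsub>H\<^esub> h \<otimes>\<^bsub>H\<^esub> inv\<^bsub>H\<^esub> x) = \<chi> x * \<chi> x"
        using x h by (simp add: mult inv)
      also have "\<dots> = 1" using sign[OF x] by auto
      finally show ?thesis using x h by simp
    qed
    ultimately have "?K \<lhd> H"
      by (subst normal_inv_iff) blast
    then have "?K = carrier H \<or> ?K = {\<one>\<^bsub>H\<^esub>}"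
      using that simple_group.no_real_normal_subgroup by blast
    moreover have "g \<notin> ?K" using \<chi>g by simp
    ultimately have K: "?K = {\<one>\<^bsub>H\<^esub>}" using g by blast
    have "h = g" if h: "h \<in> carrier H" "h \<noteq> \<one>\<^bsub>H\<^esub>" for h
    proof -
      have "\<chi> h = -1" using h sign K by blast
      then have "h \<otimes>\<^bsub>H\<^esub> inv\<^bsub>H\<^esub> g \<in> ?K" using h g by (simp add: mult inv \<chi>g)
      then have "h \<otimes>\<^bsub>H\<^esub> inv\<^bsub>H\<^esub> g = \<one>\<^bsub>H\<^esub>" using K by blast
      then have "h = inv\<^bsub>H\<^esub> (inv\<^bsub>H\<^esub> g)" using h g by (metis inv_equality inv_closed)
      then show ?thesis using g by simp
    qed
    then have "carrier H = {\<one>\<^bsub>H\<^esub>, g}" using g by auto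
    moreover have "g \<noteq> \<one>\<^bsub>H\<^esub>" using \<chi>g one by auto
    ultimately have "Coset.order H = 2"
      by (metis Coset.order_def card_2_iff)
    then show False using that by simp
  qed
  show False
    using H odd_case simple_case by (auto simp: simple_or_odd_def)
qed

section \<open>Automorphisms and translations of the graphs\<close>

lemma group_graph_aut_group: "group (graph_aut_group \<Gamma>)"
proof -
  let ?V = "verts \<Gamma>"
  let ?C = "{\<pi> \<in> Bij ?V. \<forall>x\<in>?V. \<forall>y\<in>?V. edges \<Gamma> (\<pi> x) (\<pi> y) = edges \<Gamma> x y}"
  have "subgroup ?C (BijGroup ?V)"
  proof (rule group.subgroupI[OF group_BijGroup])
    show "?C \<subseteq> carrier (BijGroup ?V)" by (auto simp: BijGroup_def)
    show "?C \<noteq> {}" using id_Bij[of ?V] by (auto intro!: exI[of _ "\<lambda>x\<in>?V. x"])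
  next
    fix \<pi> assume \<pi>: "\<pi> \<in> ?C"
    then have b: "\<pi> \<in> Bij ?V" by simp
    have "edges \<Gamma> (inv_into ?V \<pi> x) (inv_into ?V \<pi> y) = edges \<Gamma> x y" if "x \<in> ?V" "y \<in> ?V" for x y
    proof -
      have *: "\<pi> (inv_into ?V \<pi> z) = z" "inv_into ?V \<pi> z \<in> ?V" if "z \<in> ?V" for z
        using b that Bij_inv_into_mem[OF b] by (auto simp: Bij_def bij_betw_def f_inv_into_f)
      show ?thesis using \<pi> *[OF that(1)] *[OF that(2)] by force
    qed
    \<comment> \<open>Elements of \<open>Bij\<close> are extensional, so the inverse has to be
      restricted to the vertices.\<close>
    then have "(\<lambda>x\<in>?V. inv_into ?V \<pi> x) \<in> ?C"
      using restrict_inv_into_Bij[OF b] by simp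
    then show "inv\<^bsub>BijGroup ?V\<^esub> \<pi> \<in> ?C"
      by (simp only: inv_BijGroup[OF b])
  next
    fix \<pi> \<rho> assume *: "\<pi> \<in> ?C" "\<rho> \<in> ?C"
    then have "\<rho> x \<in> ?V" if "x \<in> ?V" for x
      using that Bij_imp_funcset[of \<rho> ?V] by auto
    with * show "\<pi> \<otimes>\<^bsub>BijGroup ?V\<^esub> \<rho> \<in> ?C"
      by (auto simp: BijGroup_def compose_Bij) (simp add: compose_def)
  qed
  then show ?thesis
    unfolding graph_aut_group_def by (rule group.subgroup_imp_group[OF group_BijGroup])
qed

text \<open>Replacing \<open>y\<close> by \<open>y \<otimes> g\<close> multiplies
  \<open>s \<otimes> \<tau> y\<close> by \<open>\<tau> g\<close> on the right, and
  \<open>inv (\<tau> y) \<otimes> s\<close> by \<open>inv (\<tau> g)\<close> on the left; this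
  dictates \<open>P\<close>. The untwisted graphs are the case of the identity
  \<open>\<tau>\<close>.\<close>

lemma group_graph_aut_pair:
  assumes "group_graph G \<Gamma>" "g \<in> carrier G"
  obtains P where "aut_pair (verts \<Gamma>) (edges \<Gamma>) P (\<lambda>y. y \<otimes>\<^bsub>G\<^esub> g)"
proof -
  interpret group G using assms by (simp add: group_graph_def)
  have translate: "bij_betw (\<lambda>y. y \<otimes>\<^bsub>G\<^esub> h) (carrier G) (carrier G)"
    "bij_betw (\<lambda>y. h \<otimes>\<^bsub>G\<^esub> y) (carrier G) (carrier G)" if "h \<in> carrier G" for h
    using that inj_on_multc[of h] surj_const_mult[of h] inj_on_cmult[of h]
    by (auto simp: bij_betw_def image_iff) (metis inv_solve_right m_closed inv_closed)
  have cayley: "aut_pair (carrier G) (edges \<Gamma>) (\<lambda>x. x \<otimes>\<^bsub>G\<^esub> \<tau> g) (\<lambda>y. y \<otimes>\<^bsub>G\<^esub> g)"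
    if S: "set_mset S \<subseteq> carrier G" and \<tau>: "\<tau> \<in> hom G G"
      and e: "\<And>x y. x \<in> carrier G \<Longrightarrow> y \<in> carrier G \<Longrightarrow>
        edges \<Gamma> x y = size {# s \<in># S. x = s \<otimes>\<^bsub>G\<^esub> \<tau> y #}" for S \<tau>
  proof -
    have \<tau>_in: "\<tau> x \<in> carrier G" if "x \<in> carrier G" for x
      using hom_in_carrier[OF \<tau> that] .
    have "edges \<Gamma> (x \<otimes>\<^bsub>G\<^esub> \<tau> g) (y \<otimes>\<^bsub>G\<^esub> g) = edges \<Gamma> x y"
      if xy: "x \<in> carrier G" "y \<in> carrier G" for x y
    proof -
      have "x \<otimes>\<^bsub>G\<^esub> \<tau> g = s \<otimes>\<^bsub>G\<^esub> \<tau> (y \<otimes>\<^bsub>G\<^esub> g) \<longleftrightarrow> x = s \<otimes>\<^bsub>G\<^esub> \<tau> y" if "s \<in># S" for s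
      proof -
        have "s \<in> carrier G" using that S by blast
        then show ?thesis
          using xy assms(2) \<tau>_in by (simp add: hom_mult[OF \<tau>] m_assoc[symmetric])
      qed
      then have "{# s \<in># S. x \<otimes>\<^bsub>G\<^esub> \<tau> g = s \<otimes>\<^bsub>G\<^esub> \<tau> (y \<otimes>\<^bsub>G\<^esub> g) #} = {# s \<in># S. x = s \<otimes>\<^bsub>G\<^esub> \<tau> y #}"
        by (intro filter_mset_cong) auto
      then show ?thesis using xy assms(2) \<tau>_in by (simp add: e)
    qed
    then show ?thesis
      using translate \<tau>_in assms(2) by (simp add: aut_pair_def)
  qed
  have cayley_sum: "aut_pair (carrier G) (edges \<Gamma>) (\<lambda>x. inv\<^bsub>G\<^esub> (\<tau> g) \<otimes>\<^bsub>G\<^esub> x) (\<lambda>y. y \<otimes>\<^bsub>G\<^esub> g)"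
    if S: "set_mset S \<subseteq> carrier G" and \<tau>: "\<tau> \<in> hom G G"
      and e: "\<And>x y. x \<in> carrier G \<Longrightarrow> y \<in> carrier G \<Longrightarrow>
        edges \<Gamma> x y = size {# s \<in># S. x = inv\<^bsub>G\<^esub> (\<tau> y) \<otimes>\<^bsub>G\<^esub> s #}" for S \<tau>
  proof -
    have \<tau>_in: "\<tau> x \<in> carrier G" if "x \<in> carrier G" for x
      using hom_in_carrier[OF \<tau> that] .
    have "edges \<Gamma> (inv\<^bsub>G\<^esub> (\<tau> g) \<otimes>\<^bsub>G\<^esub> x) (y \<otimes>\<^bsub>G\<^esub> g) = edges \<Gamma> x y"
      if xy: "x \<in> carrier G" "y \<in> carrier G" for x y
    proof -
      have "inv\<^bsub>G\<^esub> (\<tau> g) \<otimes>\<^bsub>G\<^esub> x = inv\<^bsub>G\<^esub> (\<tau> (y \<otimes>\<^bsub>G\<^esub> g)) \<otimes>\<^bsub>G\<^esub> s \<longleftrightarrow> x = inv\<^bsub>G\<^esub> (\<tau> y) \<otimes>\<^bsub>G\<^esub> s"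
        if "s \<in># S" for s
      proof -
        have "s \<in> carrier G" using that S by blast
        then show ?thesis
          using xy assms(2) \<tau>_in by (simp add: hom_mult[OF \<tau>] inv_mult_group m_assoc)
      qed
      then have "{# s \<in># S. inv\<^bsub>G\<^esub> (\<tau> g) \<otimes>\<^bsub>G\<^esub> x = inv\<^bsub>G\<^esub> (\<tau> (y \<otimes>\<^bsub>G\<^esub> g)) \<otimes>\<^bsub>G\<^esub> s #}
          = {# s \<in># S. x = inv\<^bsub>G\<^esub> (\<tau> y) \<otimes>\<^bsub>G\<^esub> s #}"
        by (intro filter_mset_cong) auto
      then show ?thesis using xy assms(2) \<tau>_in by (simp add: e)
    qed
    then show ?thesis
      using translate \<tau>_in assms(2) by (simp add: aut_pair_def)
  qed
  obtain S \<sigma> where S: "set_mset S \<subseteq> carrier G" and \<sigma>: "\<sigma> \<in> hom G G"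
    and kind: "cayley_graph G S \<Gamma> \<or> cayley_sum_graph G S \<Gamma> \<or>
      twisted_cayley_graph G S \<sigma> \<Gamma> \<or> twisted_cayley_sum_graph G S \<sigma> \<Gamma>"
    using assms(1) by (auto simp: group_graph_def iso_def)
  have id: "(\<lambda>x. x) \<in> hom G G" by (auto simp: hom_def)
  from kind show thesis
  proof (elim disjE)
    assume "cayley_graph G S \<Gamma>"
    then show thesis
      using that cayley[OF S id] by (simp add: cayley_graph_def)
  next
    assume "cayley_sum_graph G S \<Gamma>"
    then show thesis
      using that cayley_sum[OF S id] by (simp add: cayley_sum_graph_def)
  next
    assume "twisted_cayley_graph G S \<sigma> \<Gamma>"
    then show thesis
      using that cayley[OF S \<sigma>] by (simp add: twisted_cayley_graph_def)
  next
    assume "twisted_cayley_sum_graph G S \<sigma> \<Gamma>"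
    then show thesis
      using that cayley_sum[OF S \<sigma>] by (simp add: twisted_cayley_sum_graph_def)
  qed
qed

lemma group_graph_verts: "group_graph G \<Gamma> \<Longrightarrow> verts \<Gamma> = carrier G"
  by (auto simp: group_graph_def cayley_graph_def cayley_sum_graph_def
      twisted_cayley_graph_def twisted_cayley_sum_graph_def)

lemma aut_pair_graph_aut:
  "\<pi> \<in> carrier (graph_aut_group \<Gamma>) \<Longrightarrow> aut_pair (verts \<Gamma>) (edges \<Gamma>) \<pi> \<pi>"
  by (simp add: graph_aut_group_def aut_pair_def Bij_def)

text \<open>In a group, right translation by \<open>inv x \<otimes> y\<close> takes \<open>x\<close>
  to \<open>y\<close>; in a vertex-transitive graph an automorphism serves as both members of the
  pair.\<close>

lemma transitive_aut_pairs:
  assumes "(\<exists>G. group_graph G \<Gamma>) \<or> vertex_transitive_graph \<Gamma>" "x \<in> verts \<Gamma>" "y \<in> verts \<Gamma>"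
  shows "\<exists>P Q. aut_pair (verts \<Gamma>) (edges \<Gamma>) P Q \<and> Q x = y"
  using assms(1)
proof
  assume "\<exists>G. group_graph G \<Gamma>"
  then obtain G where G: "group_graph G \<Gamma>" by blast
  interpret group G using G by (simp add: group_graph_def)
  have xy: "x \<in> carrier G" "y \<in> carrier G" using assms group_graph_verts[OF G] by auto
  then obtain P where "aut_pair (verts \<Gamma>) (edges \<Gamma>) P (\<lambda>z. z \<otimes>\<^bsub>G\<^esub> (inv\<^bsub>G\<^esub> x \<otimes>\<^bsub>G\<^esub> y))"
    using group_graph_aut_pair[OF G] by (metis inv_closed m_closed)
  moreover have "x \<otimes>\<^bsub>G\<^esub> (inv\<^bsub>G\<^esub> x \<otimes>\<^bsub>G\<^esub> y) = y"
    using xy by (simp add: m_assoc[symmetric])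
  ultimately show ?thesis by blast
next
  assume "vertex_transitive_graph \<Gamma>"
  then obtain \<pi> where "\<pi> \<in> carrier (graph_aut_group \<Gamma>)" "\<pi> x = y"
    using assms by (auto simp: vertex_transitive_graph_def)
  then show ?thesis using aut_pair_graph_aut by blast
qed

section \<open>The normalized adjacency operator of a graph\<close>

text \<open>Passes from the matrix to functions on the vertices, so that the chosen enumeration
  disappears. Only membership is described, not multiplicity.\<close>

lemma eigenvalue_mset_iff:
  assumes "finite (verts \<Gamma>)"
  shows "k \<in># eigenvalue_mset (normalized_adjacency \<Gamma> d) \<longleftrightarrow>
    (\<exists>f x. x \<in> verts \<Gamma> \<and> f x \<noteq> 0 \<and>
      (\<forall>x\<in>verts \<Gamma>. (\<Sum>y\<in>verts \<Gamma>. real (edges \<Gamma> x y) / real d * f y) = k * f x))"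
proof -
  let ?M = "normalized_adjacency \<Gamma> d" and ?V = "verts \<Gamma>" and ?n = "card (verts \<Gamma>)"
  define vs where "vs = vertex_list \<Gamma>"
  have "\<exists>vs. distinct vs \<and> set vs = ?V"
    using finite_distinct_list[OF assms] by blast
  then have "distinct vs \<and> set vs = ?V"
    unfolding vs_def vertex_list_def by (rule someI_ex)
  then have vs: "distinct vs" "set vs = ?V" by auto
  then have len: "length vs = ?n" using distinct_card by fastforce
  have all: "(\<forall>x\<in>?V. R x) \<longleftrightarrow> (\<forall>i<?n. R (vs ! i))" for R
    using all_set_conv_all_nth[of vs R] by (simp add: vs len)
  have bij: "bij_betw ((!) vs) {0..<?n} ?V"
    using bij_betw_nth[OF vs(1)] len vs by (simp add: atLeast0LessThan)
  have M: "?M \<in> carrier_mat ?n ?n"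
    by (simp add: normalized_adjacency_def adjacency_matrix_def)
  \<comment> \<open>Membership in \<open>proots\<close> means being a root only for a nonzero
    polynomial.\<close>
  have "char_poly ?M \<noteq> 0"
    using degree_monic_char_poly[OF M] by auto
  then have "k \<in># eigenvalue_mset ?M \<longleftrightarrow> eigenvalue ?M k"
    by (simp add: eigenvalue_mset_def eigenvalue_root_char_poly[OF M])
  also have "\<dots> \<longleftrightarrow> (\<exists>v. v \<in> carrier_vec ?n \<and> v \<noteq> 0\<^sub>v ?n \<and> ?M *\<^sub>v v = k \<cdot>\<^sub>v v)"
    using M by (simp add: eigenvalue_def eigenvector_def)
  finally have 1: "k \<in># eigenvalue_mset ?M \<longleftrightarrow> \<dots>" .
  \<comment> \<open>\<open>f\<close> and \<open>v\<close> are tied only at the enumerated vertices,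
    so the equivalence serves both directions below.\<close>
  have mult: "?M *\<^sub>v v = k \<cdot>\<^sub>v v \<longleftrightarrow>
      (\<forall>x\<in>?V. (\<Sum>y\<in>?V. real (edges \<Gamma> x y) / real d * f y) = k * f x)"
    if v: "v \<in> carrier_vec ?n" and f: "\<And>i. i < ?n \<Longrightarrow> f (vs ! i) = v $ i" for v f
  proof -
    have entry: "(?M *\<^sub>v v) $ i = (\<Sum>y\<in>?V. real (edges \<Gamma> (vs ! i) y) / real d * f y)"
      if i: "i < ?n" for i
    proof -
      have "(?M *\<^sub>v v) $ i = (\<Sum>j\<in>{0..<?n}. real (edges \<Gamma> (vs ! i) (vs ! j)) / real d * f (vs ! j))"
        using i v by (simp add: normalized_adjacency_def adjacency_matrix_def scalar_prod_def f
            vs_def[symmetric])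
      also have "\<dots> = (\<Sum>y\<in>?V. real (edges \<Gamma> (vs ! i) y) / real d * f y)"
        by (rule sum.reindex_bij_betw[OF bij])
      finally show ?thesis .
    qed
    have "?M *\<^sub>v v = k \<cdot>\<^sub>v v \<longleftrightarrow> (\<forall>i<?n. (?M *\<^sub>v v) $ i = k * f (vs ! i))"
      using v M f by (auto simp: vec_eq_iff)
    also have "\<dots> \<longleftrightarrow> (\<forall>x\<in>?V. (\<Sum>y\<in>?V. real (edges \<Gamma> x y) / real d * f y) = k * f x)"
      unfolding all by (simp add: entry)
    finally show ?thesis .
  qed
  show ?thesis unfolding 1
  proof safe
    fix v assume v: "v \<in> carrier_vec ?n" "v \<noteq> 0\<^sub>v ?n" "?M *\<^sub>v v = k \<cdot>\<^sub>v v"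
    define f where "f x = v $ inv_into {0..<?n} ((!) vs) x" for x
    have f: "f (vs ! i) = v $ i" if "i < ?n" for i
      using that bij by (simp add: f_def bij_betw_def inv_into_f_f)
    obtain i where i: "i < ?n" "v $ i \<noteq> 0" using v(1,2) by (auto simp: vec_eq_iff)
    show "\<exists>f x. x \<in> ?V \<and> f x \<noteq> 0 \<and>
      (\<forall>x\<in>?V. (\<Sum>y\<in>?V. real (edges \<Gamma> x y) / real d * f y) = k * f x)"
    proof (intro exI conjI)
      show "vs ! i \<in> ?V" using i vs len by (metis nth_mem)
      show "f (vs ! i) \<noteq> 0" using f i by simp
      show "\<forall>x\<in>?V. (\<Sum>y\<in>?V. real (edges \<Gamma> x y) / real d * f y) = k * f x"
        using mult[OF v(1) f] v(3) by simp
    qed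
  next
    fix f :: "_ \<Rightarrow> real" and x
    assume f: "x \<in> ?V" "f x \<noteq> 0"
      "\<forall>x\<in>?V. (\<Sum>y\<in>?V. real (edges \<Gamma> x y) / real d * f y) = k * f x"
    define v where "v = vec ?n (\<lambda>i. f (vs ! i))"
    have v: "v \<in> carrier_vec ?n" "\<And>i. i < ?n \<Longrightarrow> f (vs ! i) = v $ i" by (auto simp: v_def)
    obtain i where i: "i < ?n" "vs ! i = x"
      using f(1) vs len by (metis in_set_conv_nth)
    then have "v $ i \<noteq> 0" using v f(2) by metis
    with i have "v \<noteq> 0\<^sub>v ?n" by auto
    then show "\<exists>v. v \<in> carrier_vec ?n \<and> v \<noteq> 0\<^sub>v ?n \<and> ?M *\<^sub>v v = k \<cdot>\<^sub>v v"
      using v(1) mult[OF v] f(3) by blast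
  qed
qed

section \<open>Dichotomy for the smallest eigenvalue\<close>

text \<open>Either a bound independent of the degree holds, or the nearly bipartite analysis applies
  and leaves a nowhere zero \<open>f\<close> on which automorphism pairs act by signs. The condition
  on the group is used only later, to exclude such an \<open>f\<close>.\<close>

lemma spectral_alternative:
  fixes \<Gamma> :: "'v multigraph" and d :: nat
  defines "\<mu> \<equiv> smallest_eigenvalue (normalized_adjacency \<Gamma> d)"
    and "\<mu>\<^sub>2 \<equiv> second_largest_eigenvalue (normalized_adjacency \<Gamma> d)"
  assumes fin: "finite (verts \<Gamma>)" and card: "card (verts \<Gamma>) \<ge> 2"
    and und: "undirected \<Gamma>" and conn: "connected_graph \<Gamma>" and nbip: "\<not> bipartite_graph \<Gamma>"
    and reg: "regular \<Gamma> d"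
    and trans: "\<And>x y. x \<in> verts \<Gamma> \<Longrightarrow> y \<in> verts \<Gamma> \<Longrightarrow>
      \<exists>P Q. aut_pair (verts \<Gamma>) (edges \<Gamma>) P Q \<and> Q x = y"
  obtains "1 - \<mu>\<^sub>2 \<le> 10 * (1 + \<mu>)" "0 < d" "0 \<le> 1 + \<mu>"
  | f where "2 / d \<le> 1 + \<mu>" "1 - \<mu>\<^sub>2 \<le> 2" "0 < d"
      "(\<Sum>x\<in>verts \<Gamma>. f x) = (0::real)" "\<And>x. x \<in> verts \<Gamma> \<Longrightarrow> f x \<noteq> 0"
      "\<And>P Q. aut_pair (verts \<Gamma>) (edges \<Gamma>) P Q \<Longrightarrow>
        \<exists>c. (c = 1 \<or> c = -1) \<and> (\<forall>y\<in>verts \<Gamma>. f (Q y) = c * f y)"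
proof -
  define V where "V = verts \<Gamma>"
  define w where "w x y = real (edges \<Gamma> x y) / real d" for x y
  let ?E = "eigenvalue_mset (normalized_adjacency \<Gamma> d)"
  obtain a0 b0 where ab0: "a0 \<in> V" "b0 \<in> V" "a0 \<noteq> b0"
    using card fin unfolding V_def by (metis card_le_Suc0_iff_eq not_less_eq_eq numeral_2_eq_2)
  \<comment> \<open>A path between two distinct vertices starts with an edge at
    \<open>a0\<close>.\<close>
  have "d > 0"
  proof -
    have "(a0, b0) \<in> (adjacency \<Gamma>)\<^sup>*"
      using conn ab0 by (simp add: connected_graph_def V_def)
    then obtain c where "(a0, c) \<in> adjacency \<Gamma>"
      using ab0(3) by (meson converse_rtranclE)
    then have "c \<in> V" "edges \<Gamma> a0 c > 0" by (auto simp: adjacency_def V_def)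
    then have "(\<Sum>y\<in>V. edges \<Gamma> a0 y) > 0" using fin by (auto simp: V_def intro!: sum_pos2)
    then show ?thesis using reg ab0 by (simp add: regular_def V_def)
  qed
  interpret connected_kernel V w
  proof unfold_locales
    fix x assume "x \<in> V"
    then have "real (\<Sum>y\<in>V. edges \<Gamma> x y) = real d"
      using reg by (simp add: regular_def V_def)
    then show "(\<Sum>y\<in>V. w x y) = 1"
      using \<open>d > 0\<close> by (simp add: w_def sum_divide_distrib[symmetric])
  next
    fix x y assume "x \<in> V" "y \<in> V"
    then have "(x, y) \<in> (adjacency \<Gamma>)\<^sup>*" using conn by (simp add: connected_graph_def V_def)
    then show "(x, y) \<in> {(x, y). x \<in> V \<and> y \<in> V \<and> 0 < w x y}\<^sup>*"
      using \<open>d > 0\<close> by (simp add: adjacency_def V_def w_def zero_less_divide_iff)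
  qed (use fin und in \<open>auto simp: V_def w_def undirected_def\<close>)
  have E: "k \<in># ?E \<longleftrightarrow> (\<exists>f x. x \<in> V \<and> f x \<noteq> 0 \<and> eigenfunction k f)" for k
    unfolding eigenvalue_mset_iff[OF fin] eigenfunction_def avg_def w_def V_def[symmetric] ..
  have E1: "1 \<in># ?E"
    unfolding E using ab0 by (intro exI[of _ "\<lambda>_. 1"] exI[of _ a0]) (simp add: eigenfunction_def avg_const)
  have "\<mu> \<in># ?E" and \<mu>_le: "\<And>k. k \<in># ?E \<Longrightarrow> \<mu> \<le> k"
    using E1 unfolding \<mu>_def smallest_eigenvalue_def
    by (metis Min_in finite_set_mset empty_iff) (simp add: Min_le)
  then obtain f x0 where x0: "x0 \<in> V" "f x0 \<noteq> 0" and f: "eigenfunction \<mu> f"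
    unfolding E by blast
  have "-1 \<le> \<mu>" using eigenvalue_bounds[OF f x0] by simp
  obtain \<nu> g where g: "eigenfunction \<nu> g" "(\<Sum>x\<in>V. g x) = 0" "ip g g = 1"
    and poinc: "\<And>h. (\<Sum>x\<in>V. h x) = 0 \<Longrightarrow> ip h (avg h) \<le> \<nu> * ip h h"
    using exists_second_eigenfunction card unfolding V_def by blast
  obtain x1 where x1: "x1 \<in> V" "g x1 \<noteq> 0"
    using g(3) ip_eq_0_iff[of g] by auto
  have "\<nu> \<noteq> 1" using eigenfunction_one_zero[of g x1] g x1 by auto
  with eigenvalue_bounds[OF g(1) x1] have \<nu>: "\<nu> < 1" "-1 \<le> \<nu>" by auto
  have \<nu>E: "\<nu> \<in># ?E" unfolding E using g x1 by blast
  have "Max_mset ?E = 1"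
    using E1 E eigenvalue_bounds by (intro Max_eqI) auto
  \<comment> \<open>Removing one copy of the top eigenvalue 1 leaves \<open>\<nu>\<close>, since it
    differs from 1. The resulting \<open>\<nu> \<le> \<mu>\<^sub>2\<close> bounds
    \<open>1 - \<mu>\<^sub>2\<close> by \<open>1 - \<nu>\<close>.\<close>
  then have "\<nu> \<in># ?E - {# Max_mset ?E #}"
    using \<nu>E \<open>\<nu> \<noteq> 1\<close> by (simp add: in_diff_count)
  then have \<nu>_le: "\<nu> \<le> \<mu>\<^sub>2"
    unfolding \<mu>\<^sub>2_def second_largest_eigenvalue_def by (intro Max_ge) auto
  show thesis
  proof (cases "1 - \<nu> \<le> 10 * (1 + \<mu>)")
    case True
    then show thesis using that(1) \<nu>_le \<open>d > 0\<close> \<open>-1 \<le> \<mu>\<close> by simp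
  next
    case False
    interpret nearly_bipartite V w \<nu> \<mu>
      by unfold_locales (use poinc \<nu> False \<open>-1 \<le> \<mu>\<close> card in \<open>auto simp: V_def\<close>)
    have pair: "aut_pair V w P Q" if "aut_pair V (edges \<Gamma>) P Q" for P Q
      using that by (simp add: aut_pair_def w_def)
    have tr: "\<exists>P Q. aut_pair V w P Q \<and> Q x = y" if "x \<in> V" "y \<in> V" for x y
      using trans that pair unfolding V_def by blast
    have nz: "f x \<noteq> 0" if "x \<in> V" for x
      using abs_const[OF f tr x0 that] x0 by auto
    have "\<mu> \<noteq> 1" using \<mu>_le[OF \<nu>E] \<nu> by simp
    then have s0: "(\<Sum>x\<in>V. f x) = 0" using sum_eigenfunction[OF f] by simp
    \<comment> \<open>Otherwise the sets where \<open>f\<close> is positive and negative would form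
      a bipartition.\<close>
    have "\<exists>a b. (a, b) \<in> adjacency \<Gamma> \<and> f a * f b > 0"
    proof (rule ccontr)
      assume no: "\<not> ?thesis"
      have "x \<in> {x\<in>V. f x > 0} \<and> y \<in> {x\<in>V. f x < 0} \<or> x \<in> {x\<in>V. f x < 0} \<and> y \<in> {x\<in>V. f x > 0}"
        if xy: "(x, y) \<in> adjacency \<Gamma>" for x y
      proof -
        have "x \<in> V" "y \<in> V" using xy by (auto simp: adjacency_def V_def)
        moreover from this have "f x \<noteq> 0" "f y \<noteq> 0" using nz by auto
        moreover have "\<not> f x * f y > 0" using no xy by blast
        ultimately show ?thesis by (auto simp: zero_less_mult_iff)
      qed
      moreover have "{x\<in>V. f x > 0} \<union> {x\<in>V. f x < 0} = verts \<Gamma>"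
        using nz by (auto simp: V_def) (metis linorder_neqE_linordered_idom)
      moreover have "{x\<in>V. f x > 0} \<inter> {x\<in>V. f x < 0} = {}" by auto
      ultimately have "bipartite_graph \<Gamma>"
        unfolding bipartite_graph_def by blast
      with nbip show False by simp
    qed
    then obtain a b where ab: "a \<in> V" "b \<in> V" "edges \<Gamma> a b > 0" "f a * f b > 0"
      by (auto simp: adjacency_def V_def)
    \<comment> \<open>At least one edge joins \<open>a\<close> and \<open>b\<close>; this is how the
      degree enters the bound.\<close>
    have "w a b \<ge> 1 / d" using ab \<open>d > 0\<close> by (simp add: w_def divide_right_mono)
    then have "2 * (1 / d) \<le> 1 + \<mu>"
      using monochromatic_edge_bound[OF f tr ab(1,2,4), of "1 / d"] by simp
    moreover have "\<exists>c. (c = 1 \<or> c = -1) \<and> (\<forall>y\<in>V. f (Q y) = c * f y)"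
      if "aut_pair V (edges \<Gamma>) P Q" for P Q
      using pull_back_sign[OF f pair[OF that] x0] by metis
    moreover have "1 - \<mu>\<^sub>2 \<le> 2" using \<nu> \<nu>_le by linarith
    ultimately show thesis
      using that(2)[of f] s0 nz \<open>d > 0\<close> unfolding V_def by simp
  qed
qed

section \<open>Constancy of the eigenfunction from triviality of sign characters\<close>

text \<open>Right translation by \<open>g\<close> multiplies \<open>f\<close> by a sign, which
  evaluation at the identity shows to be \<open>f g / f \<one>\<close>. These signs form a character
  of \<open>G\<close>, hence are all 1.\<close>

lemma group_graph_function_const:
  fixes f :: "'v \<Rightarrow> real" and G (structure)
  assumes G: "group_graph G \<Gamma>" "simple_or_odd G"
    and nz: "\<And>x. x \<in> verts \<Gamma> \<Longrightarrow> f x \<noteq> 0"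
    and sign: "\<And>P Q. aut_pair (verts \<Gamma>) (edges \<Gamma>) P Q \<Longrightarrow>
        \<exists>c. (c = 1 \<or> c = -1) \<and> (\<forall>y\<in>verts \<Gamma>. f (Q y) = c * f y)"
    and x: "x \<in> verts \<Gamma>"
  shows "f x = f \<one>"
proof -
  interpret group G using G by (simp add: group_graph_def)
  note V = group_graph_verts[OF G(1)]
  define \<chi> where "\<chi> g = f g / f \<one>" for g
  have \<chi>: "(\<chi> g = 1 \<or> \<chi> g = -1) \<and> (\<forall>y\<in>carrier G. f (y \<otimes> g) = \<chi> g * f y)"
    if g: "g \<in> carrier G" for g
  proof -
    obtain P where "aut_pair (verts \<Gamma>) (edges \<Gamma>) P (\<lambda>y. y \<otimes> g)"
      using group_graph_aut_pair[OF G(1) g] .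
    then obtain c where c: "c = 1 \<or> c = -1" "\<forall>y\<in>carrier G. f (y \<otimes> g) = c * f y"
      using sign V by metis
    moreover have "c = \<chi> g"
      using c(2)[rule_format, of \<one>] g nz[of \<one>] V by (simp add: \<chi>_def)
    ultimately show ?thesis by simp
  qed
  have "\<chi> x = 1"
  proof (rule sign_character_trivial[OF is_group G(2)])
    fix g h assume "g \<in> carrier G" "h \<in> carrier G"
    then show "\<chi> (g \<otimes> h) = \<chi> g * \<chi> h"
      using \<chi>[of h] by (simp add: \<chi>_def)
  qed (use \<chi> x V in auto)
  then show ?thesis using nz[of \<one>] V by (simp add: \<chi>_def field_simps)
qed

text \<open>The same argument for the automorphism group, with the base point \<open>a\<close> in
  the role of the identity; transitivity reaches every vertex from \<open>a\<close>.\<close>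

lemma vertex_transitive_function_const:
  fixes f :: "'v \<Rightarrow> real"
  assumes vt: "vertex_transitive_graph \<Gamma>" "simple_or_odd (graph_aut_group \<Gamma>)"
    and nz: "\<And>x. x \<in> verts \<Gamma> \<Longrightarrow> f x \<noteq> 0"
    and sign: "\<And>P Q. aut_pair (verts \<Gamma>) (edges \<Gamma>) P Q \<Longrightarrow>
        \<exists>c. (c = 1 \<or> c = -1) \<and> (\<forall>y\<in>verts \<Gamma>. f (Q y) = c * f y)"
    and x: "x \<in> verts \<Gamma>" and a: "a \<in> verts \<Gamma>"
  shows "f x = f a"
proof -
  let ?H = "graph_aut_group \<Gamma>"
  define \<chi> where "\<chi> \<pi> = f (\<pi> a) / f a" for \<pi>
  have \<chi>: "(\<chi> \<pi> = 1 \<or> \<chi> \<pi> = -1) \<and> (\<forall>y\<in>verts \<Gamma>. f (\<pi> y) = \<chi> \<pi> * f y)"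
    if \<pi>: "\<pi> \<in> carrier ?H" for \<pi>
  proof -
    obtain c where c: "c = 1 \<or> c = -1" "\<forall>y\<in>verts \<Gamma>. f (\<pi> y) = c * f y"
      using sign[OF aut_pair_graph_aut[OF \<pi>]] by metis
    moreover have "c = \<chi> \<pi>"
      using c(2) a nz[of a] by (simp add: \<chi>_def)
    ultimately show ?thesis by simp
  qed
  obtain \<pi> where \<pi>: "\<pi> \<in> carrier ?H" "\<pi> a = x"
    using vt a x by (auto simp: vertex_transitive_graph_def)
  have "\<chi> \<pi> = 1"
  proof (rule sign_character_trivial[OF group_graph_aut_group vt(2), where \<chi> = \<chi>])
    fix \<rho> \<tau> assume \<rho>: "\<rho> \<in> carrier ?H" and \<tau>: "\<tau> \<in> carrier ?H"
    \<comment> \<open>The product is composition restricted to the vertices, so it can be evaluated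
      at \<open>a\<close>.\<close>
    then have "(\<rho> \<otimes>\<^bsub>?H\<^esub> \<tau>) a = \<rho> (\<tau> a)"
      using a by (simp add: graph_aut_group_def BijGroup_def compose_def)
    moreover have "\<tau> a \<in> verts \<Gamma>"
      using aut_pair_in[OF aut_pair_graph_aut[OF \<tau>] a] by simp
    ultimately show "\<chi> (\<rho> \<otimes>\<^bsub>?H\<^esub> \<tau>) = \<chi> \<rho> * \<chi> \<tau>"
      using \<chi>[OF \<rho>] by (simp add: \<chi>_def)
  qed (use \<chi> \<pi> in auto)
  then show ?thesis using nz[OF a] \<pi> by (simp add: \<chi>_def field_simps)
qed

theorem theorem1p1:
  fixes \<Gamma> :: "'v multigraph" and d :: nat and \<mu> \<mu>\<^sub>2 :: real
  assumes "finite (verts \<Gamma>)" and "card (verts \<Gamma>) \<ge> 2"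
    and "(\<exists>G. group_graph G \<Gamma>) \<or> vertex_transitive_graph \<Gamma>"
    and "undirected \<Gamma>" and "connected_graph \<Gamma>" and "\<not> bipartite_graph \<Gamma>"
    and "regular \<Gamma> d"
    and "\<mu> = smallest_eigenvalue (normalized_adjacency \<Gamma> d)"
    and "\<mu>\<^sub>2 = second_largest_eigenvalue (normalized_adjacency \<Gamma> d)"
  shows "1 + \<mu> \<ge> (1 - \<mu>\<^sub>2) / (50000 * real d) \<and>
    ((\<exists>G. group_graph G \<Gamma> \<and> simple_or_odd G) \<or>
      (vertex_transitive_graph \<Gamma> \<and> simple_or_odd (graph_aut_group \<Gamma>))
     \<longrightarrow> 1 + \<mu> \<ge> (1 - \<mu>\<^sub>2) / 2525)"
proof (rule spectral_alternative[OF assms(1,2,4-7) transitive_aut_pairs[OF assms(3)],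
      folded assms(8,9)])
  assume *: "1 - \<mu>\<^sub>2 \<le> 10 * (1 + \<mu>)" "0 < d" "0 \<le> 1 + \<mu>"
  \<comment> \<open>Both denominators are at least 10 because \<open>d\<close> is at least 1, and
    \<open>1 + \<mu>\<close> is nonnegative.\<close>
  have "10 * (1 + \<mu>) \<le> (50000 * real d) * (1 + \<mu>)" "10 * (1 + \<mu>) \<le> 2525 * (1 + \<mu>)"
    using * by (intro mult_right_mono; simp)+
  with * show ?thesis by (simp add: field_simps)
next
  fix f :: "'v \<Rightarrow> real"
  assume *: "2 / d \<le> 1 + \<mu>" "1 - \<mu>\<^sub>2 \<le> 2" "0 < d"
    and s0: "(\<Sum>x\<in>verts \<Gamma>. f x) = 0" and nz: "\<And>x. x \<in> verts \<Gamma> \<Longrightarrow> f x \<noteq> 0"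
    and sign: "\<And>P Q. aut_pair (verts \<Gamma>) (edges \<Gamma>) P Q \<Longrightarrow>
        \<exists>c. (c = 1 \<or> c = -1) \<and> (\<forall>y\<in>verts \<Gamma>. f (Q y) = c * f y)"
  have "(1 - \<mu>\<^sub>2) / (50000 * real d) \<le> 2 / (50000 * real d)"
    using * by (intro divide_right_mono) auto
  also have "\<dots> \<le> 2 / d" using *(3) by (intro divide_left_mono) auto
  finally have "(1 - \<mu>\<^sub>2) / (50000 * real d) \<le> 1 + \<mu>" using *(1) by simp
  \<comment> \<open>A constant function of sum zero vanishes, contrary to \<open>nz\<close>; thus
    the second alternative does not occur for such groups.\<close>
  moreover have False if "group_graph G \<Gamma>" "simple_or_odd G" for G
  proof -
    interpret group G using that by (simp add: group_graph_def)
    have "\<And>x. x \<in> verts \<Gamma> \<Longrightarrow> f x = f \<one>\<^bsub>G\<^esub>"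
      by (rule group_graph_function_const[OF that]) (use nz sign in blast)+
    then have "(\<Sum>x\<in>verts \<Gamma>. f x) = card (verts \<Gamma>) * f \<one>\<^bsub>G\<^esub>" by simp
    then show False using s0 nz[of "\<one>\<^bsub>G\<^esub>"] assms(2) group_graph_verts[OF that(1)] by auto
  qed
  moreover have False if "vertex_transitive_graph \<Gamma>" "simple_or_odd (graph_aut_group \<Gamma>)"
  proof -
    obtain a where a: "a \<in> verts \<Gamma>" using assms(2) by fastforce
    have "\<And>x. x \<in> verts \<Gamma> \<Longrightarrow> f x = f a"
      by (rule vertex_transitive_function_const[OF that _ _ _ a]) (use nz sign in blast)+
    then have "(\<Sum>x\<in>verts \<Gamma>. f x) = card (verts \<Gamma>) * f a" by simp
    then show False using s0 nz[OF a] assms(2) by auto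
  qed
  ultimately show ?thesis by blast
qed

end
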